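(* Suppose that $P$ is $\mu$-optimally strongly convex for some $\mu>0$. Let $\check{x}_0 \in \mathbb{R}^d$, $b \in [n]$, let $m\in\mathbb{N}$ be proportional to $n/b$ (i.e. $c_1 n/b\le m\le c_2n/b$ for fixed constants $0<c_1\le c_2$), and let $\gamma = \gamma_*=\frac12\big(3+\sqrt{9+\frac{8b}{m+1}}\big)$, $\eta=\frac{1}{(1+\gamma_*(m+1)/b)\bar L}$. For $S\in\mathbb{N}$ let $$\rho = \frac{4\left\{ \left(1-\frac{1}{\gamma_*}\right)^2 + \frac{4}{\eta(m+1)m\mu}\right\}}{\left( 1 - \frac{1}{\gamma_*}\right)^2(S+2)^2}.$$ There exists $S = O\left(1 + \left(\frac bn + \frac{1}{\sqrt{n}}\right)\sqrt{\frac{\bar L}{\mu}}\right)$ such that $\frac{1}{\log(1/\rho)} = O(1)$ (with $\rho\in(0,1)$). Moreover, for a target accuracy $\varepsilon>0$, if one appropriately chooses $T = O\left(\log\frac{P(\check{x}_0) - P(x_* )}{\varepsilon}\right)$, then the total computational cost of $\mathrm{DASVRDA}^{\mathrm{sc}}(\check x_{0}, \gamma_*, \{ L_i \}_{i=1}^n, m, b, S, T)$ for achieving $\mathbb{E} \left[P(\check{x}_{T})-P(x_{*})\right] \leq \varepsilon$ is $$O\left( d\left(n + \left(b + \sqrt{n}\right)\sqrt{\frac{\bar L}{\mu}}\right) \log\left(\frac{P(\check{x}_0) - P(x_* )}{\varepsilon}\right) \right).$$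
   Context: Setting. $n,d\ge 1$, $[n]=\{1,\dots,n\}$, $\|\cdot\|$ is the Euclidean norm on $\mathbb{R}^d$. Each $f_i:\mathbb{R}^d\to\mathbb{R}$ ($i\in[n]$) is convex, differentiable and $L_i$-smooth with $L_i>0$, i.e. $\|\nabla f_i(x)-\nabla f_i(y)\|\le L_i\|x-y\|$ for all $x,y$. $F=\frac1n\sum_{i=1}^n f_i$. $R:\mathbb{R}^d\to\mathbb{R}$ is convex (possibly non-differentiable) and relatively simple (its proximal mapping is computable at $O(d)$ cost). $P=F+R$, and $x_*$ is a minimizer of $P$, assumed to exist. A function $f$ is $\mu$-optimally strongly convex if it has a minimizer and $\frac{\mu}{2}\|x-x_*\|^2\le f(x)-f(x_* )$ for all $x\in\mathbb{R}^d$ and all minimizers $x_*$ of $f$. $\bar L=\frac1n\sum_{i=1}^n L_i$, and $Q=\{q_i\}_{i=1}^n$ is the probability distribution on $[n]$ with $q_i=\frac{L_i}{n\bar L}$. $\mathrm{prox}_{f}(y)=\mathrm{argmin}_{x}\{\frac12\|x-y\|^2+f(x)\}$. Procedure One Stage AccSVRDA$(\widetilde y,\widetilde x,\eta,m,b,Q)$: set $x_0=z_0=\widetilde y$, $\bar g_0=0$, $\theta_0=\frac12$. For $k=1,\dots,m$: draw $i_k^1,\dots,i_k^b$ independently from $Q$ (independently of the past), let $I_k$ be this sample of $b$ indices (with multiplicity); $\theta_k=\frac{k+1}{2}$; $y_k=(1-\frac1{\theta_k})x_{k-1}+\frac1{\theta_k}z_{k-1}$; $g_k=\frac1b\sum_{i\in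 I_k}\frac{1}{nq_i}(\nabla f_i(y_k)-\nabla f_i(\widetilde x))+\nabla F(\widetilde x)$; $\bar g_k=(1-\frac1{\theta_k})\bar g_{k-1}+\frac1{\theta_k}g_k$; $z_k=\mathrm{argmin}_{z}\{\langle \bar g_k,z\rangle+R(z)+\frac{1}{2\eta\theta_k\theta_{k-1}}\|z-z_0\|^2\}=\mathrm{prox}_{\eta\theta_k\theta_{k-1}R}(z_0-\eta\theta_k\theta_{k-1}\bar g_k)$; $x_k=(1-\frac1{\theta_k})x_{k-1}+\frac1{\theta_k}z_k$. Output $(x_m,z_m)$. Procedure $\mathrm{DASVRDA}^{\mathrm{ns}}(\widetilde x_0,\widetilde z_0,\gamma,\{L_i\},m,b,S)$ ($\gamma>1$): set $\widetilde x_{-1}=\widetilde z_0$, $\widetilde\theta_0=1-\frac1\gamma$, $\eta=\frac{1}{(1+\gamma(m+1)/b)\bar L}$. For $s=1,\dots,S$: $\widetilde\theta_s=(1-\frac1\gamma)\frac{s+2}{2}$; $\widetilde y_s=\widetilde x_{s-1}+\frac{\widetilde\theta_{s-1}-1}{\widetilde\theta_s}(\widetilde x_{s-1}-\widetilde x_{s-2})+\frac{\widetilde\theta_{s-1}}{\widetilde\theta_s}(\widetilde z_{s-1}-\widetilde x_{s-1})$; $(\widetilde x_s,\widetilde z_s)=$ One Stage AccSVRDA$(\widetilde y_s,\widetilde x_{s-1},\eta,m,b,Q)$ with fresh independent samples. Output $\widetilde x_S$. Procedure $\mathrm{DASVRDA}^{\mathrm{sc}}(\check x_0,\gamma,\{L_i\},m,b,S,T)$: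 for $t=1,\dots,T$ set $\check x_t=\mathrm{DASVRDA}^{\mathrm{ns}}(\check x_{t-1},\check x_{t-1},\gamma,\{L_i\},m,b,S)$ with fresh independent samples. Output $\check x_T$. Cost model. Evaluating one $\nabla f_i$ at a point, one proximal mapping of a multiple of $R$, or one vector operation in $\mathbb{R}^d$ costs $O(d)$; hence $\nabla F$ costs $O(nd)$ and one call of One Stage AccSVRDA with $m$ inner iterations and mini-batch size $b$ costs $O(d(n+bm))$. $O(\cdot)$ hides constants depending only on the proportionality constants $c_1,c_2$; the accuracy is understood to be nontrivial, so that the logarithm is bounded below by a positive constant (e.g. $\varepsilon\le (P(\check x_0)-P(x_* ))/2$). Expectation is over all random index draws. *)

theory Defs
  imports "HOL-Analysis.Analysis" "HOL-Probability.Probability" "HOL-Library.Poly_Mapping"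
begin

section \<open>Euclidean spaces of varying dimension\<close>

text \<open>
  The constants hidden in the O-notation must not depend on the dimension, so the dimension has to
  be quantified inside the formula and cannot be a type.  All spaces are therefore taken as
  coordinate subspaces of the space of finitely supported real sequences, with its standard inner
  product.
\<close>

instantiation poly_mapping :: (type, real_vector) real_vector
begin

definition scaleR_poly_mapping :: "real \<Rightarrow> ('a \<Rightarrow>\<^sub>0 'b) \<Rightarrow> 'a \<Rightarrow>\<^sub>0 'b" where
  "scaleR_poly_mapping r x = Poly_Mapping.map (scaleR r) x"

lemma lookup_scaleR:
  "Poly_Mapping.lookup (r *\<^sub>R x) k = r *\<^sub>R Poly_Mapping.lookup (x :: 'a \<Rightarrow>\<^sub>0 'b) k"
  unfolding scaleR_poly_mapping_def by transfer (auto simp: when_def)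

instance
  by standard
    (auto intro!: poly_mapping_eqI simp: lookup_scaleR lookup_add scaleR_add_right scaleR_add_left)

end

instantiation poly_mapping :: (type, real_inner) real_inner
begin

definition inner_poly_mapping :: "('a \<Rightarrow>\<^sub>0 'b) \<Rightarrow> ('a \<Rightarrow>\<^sub>0 'b) \<Rightarrow> real" where
  "inner_poly_mapping x y =
     (\<Sum>k\<in>Poly_Mapping.keys x. inner (Poly_Mapping.lookup x k) (Poly_Mapping.lookup y k))"

definition norm_poly_mapping :: "('a \<Rightarrow>\<^sub>0 'b) \<Rightarrow> real" where
  "norm_poly_mapping x = sqrt (inner x x)"

definition dist_poly_mapping :: "('a \<Rightarrow>\<^sub>0 'b) \<Rightarrow> ('a \<Rightarrow>\<^sub>0 'b) \<Rightarrow> real" where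
  "dist_poly_mapping x y = norm (x - y)"

definition sgn_poly_mapping :: "('a \<Rightarrow>\<^sub>0 'b) \<Rightarrow> 'a \<Rightarrow>\<^sub>0 'b" where
  "sgn_poly_mapping x = x /\<^sub>R norm x"

definition uniformity_poly_mapping :: "(('a \<Rightarrow>\<^sub>0 'b) \<times> ('a \<Rightarrow>\<^sub>0 'b)) filter" where
  "uniformity_poly_mapping = (INF e\<in>{0<..}. principal {(x, y). dist x y < e})"

definition open_poly_mapping :: "('a \<Rightarrow>\<^sub>0 'b) set \<Rightarrow> bool" where
  "open_poly_mapping U \<longleftrightarrow> (\<forall>x\<in>U. eventually (\<lambda>(x', y). x' = x \<longrightarrow> y \<in> U) uniformity)"

lemma inner_poly_mapping_superset:
  fixes x y :: "'a \<Rightarrow>\<^sub>0 'b"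
  assumes "finite A" "Poly_Mapping.keys x \<subseteq> A"
  shows "inner x y = (\<Sum>k\<in>A. inner (Poly_Mapping.lookup x k) (Poly_Mapping.lookup y k))"
  unfolding inner_poly_mapping_def
  using assms by (intro sum.mono_neutral_left) (auto simp: in_keys_iff)

instance
proof
  fix x y z :: "'a \<Rightarrow>\<^sub>0 'b" and r :: real
  show "sgn x = x /\<^sub>R norm x" "dist x y = norm (x - y)" "norm x = sqrt (inner x x)"
    by (simp_all add: sgn_poly_mapping_def dist_poly_mapping_def norm_poly_mapping_def)
  show "uniformity = (INF e\<in>{0<..}. principal {(x::'a \<Rightarrow>\<^sub>0 'b, y). dist x y < e})"
    by (rule uniformity_poly_mapping_def)
  show "open U \<longleftrightarrow> (\<forall>x\<in>U. eventually (\<lambda>(x', y). x' = x \<longrightarrow> y \<in> U) uniformity)"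
    for U :: "('a \<Rightarrow>\<^sub>0 'b) set"
    by (rule open_poly_mapping_def)
  let ?A = "Poly_Mapping.keys x \<union> Poly_Mapping.keys y"
  have fin: "finite ?A" by simp
  show "inner x y = inner y x"
    unfolding inner_poly_mapping_superset[OF fin, of x y, simplified]
      inner_poly_mapping_superset[OF fin, of y x, simplified]
    by (rule sum.cong[OF refl]) (rule inner_commute)
  show "inner (x + y) z = inner x z + inner y z"
    unfolding inner_poly_mapping_superset[OF fin, of x z, simplified]
      inner_poly_mapping_superset[OF fin, of y z, simplified]
      inner_poly_mapping_superset[OF fin Poly_Mapping.keys_add[of x y], of z]
    by (simp add: lookup_add inner_add_left sum.distrib)
  have "Poly_Mapping.keys (r *\<^sub>R x) \<subseteq> Poly_Mapping.keys x"
    by (auto simp: in_keys_iff lookup_scaleR)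
  from inner_poly_mapping_superset[OF _ this, of y]
  show "inner (r *\<^sub>R x) y = r * inner x y"
    by (simp add: lookup_scaleR inner_poly_mapping_def sum_distrib_left)
  show "0 \<le> inner x x"
    by (simp add: inner_poly_mapping_def sum_nonneg)
  have "inner x x = 0 \<longleftrightarrow> (\<forall>k\<in>Poly_Mapping.keys x. Poly_Mapping.lookup x k = 0)"
    by (simp add: inner_poly_mapping_def sum_nonneg_eq_0_iff)
  also have "\<dots> \<longleftrightarrow> x = 0"
    by (auto simp: in_keys_iff intro!: poly_mapping_eqI)
  finally show "inner x x = 0 \<longleftrightarrow> x = 0" .
qed

end

type_synonym vec = "nat \<Rightarrow>\<^sub>0 real"

definition Rd :: "nat \<Rightarrow> vec set" where
  "Rd d = {x. \<forall>i\<ge>d. Poly_Mapping.lookup x i = 0}"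

lemma subspace_Rd: "subspace (Rd d)"
  by (auto simp: subspace_def Rd_def lookup_add lookup_scaleR)

lemma inner_Rd:
  assumes "x \<in> Rd d"
  shows "inner x y = (\<Sum>i<d. Poly_Mapping.lookup x i * Poly_Mapping.lookup y i)"
proof -
  have "Poly_Mapping.keys x \<subseteq> {..<d}"
    using assms by (auto simp: Rd_def in_keys_iff) (meson not_le)
  then show ?thesis
    by (subst inner_poly_mapping_superset) simp_all
qed

lemma norm_Rd:
  assumes "x \<in> Rd d"
  shows "norm x = sqrt (\<Sum>i<d. (Poly_Mapping.lookup x i)\<^sup>2)"
  by (simp add: norm_eq_sqrt_inner inner_Rd[OF assms] power2_eq_square)

section \<open>Functions on the d-dimensional space\<close>

text \<open>
  A function on the d-dimensional space is a function on \<^typ>\<open>vec\<close> of which only the values on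
  \<^term>\<open>Rd d\<close> matter; derivatives and minimizers are taken within \<^term>\<open>Rd d\<close>.
\<close>

definition grad :: "nat \<Rightarrow> (vec \<Rightarrow> real) \<Rightarrow> vec \<Rightarrow> vec" where
  "grad d f x =
     (THE g. g \<in> Rd d \<and> (f has_derivative (\<lambda>h. inner g h)) (at x within Rd d))"

definition minimizer :: "nat \<Rightarrow> (vec \<Rightarrow> real) \<Rightarrow> vec \<Rightarrow> bool" where
  "minimizer d f x \<longleftrightarrow> is_arg_min f (\<lambda>u. u \<in> Rd d) x"

definition opt_strongly_convex :: "nat \<Rightarrow> real \<Rightarrow> (vec \<Rightarrow> real) \<Rightarrow> bool" where
  "opt_strongly_convex d \<mu> f \<longleftrightarrow>
     (\<exists>xs. minimizer d f xs) \<and>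
     (\<forall>x\<in>Rd d. \<forall>xs. minimizer d f xs \<longrightarrow> \<mu> / 2 * (norm (x - xs))\<^sup>2 \<le> f x - f xs)"

definition prox :: "nat \<Rightarrow> (vec \<Rightarrow> real) \<Rightarrow> vec \<Rightarrow> vec" where
  "prox d f y = arg_min (\<lambda>x. 1 / 2 * (norm (x - y))\<^sup>2 + f x) (\<lambda>x. x \<in> Rd d)"

section \<open>The finite-sum problem\<close>

definition Lbar :: "nat \<Rightarrow> (nat \<Rightarrow> real) \<Rightarrow> real" where
  "Lbar n L = (\<Sum>i=1..n. L i) / real n"

definition qprob :: "nat \<Rightarrow> (nat \<Rightarrow> real) \<Rightarrow> nat \<Rightarrow> real" where
  "qprob n L i = L i / (real n * Lbar n L)"

definition Qdist :: "nat \<Rightarrow> (nat \<Rightarrow> real) \<Rightarrow> nat pmf" where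
  "Qdist n L = embed_pmf (\<lambda>i. if i \<in> {1..n} then qprob n L i else 0)"

definition Fsum :: "nat \<Rightarrow> (nat \<Rightarrow> vec \<Rightarrow> real) \<Rightarrow> vec \<Rightarrow> real" where
  "Fsum n f x = (\<Sum>i=1..n. f i x) / real n"

definition Pobj :: "nat \<Rightarrow> (nat \<Rightarrow> vec \<Rightarrow> real) \<Rightarrow> (vec \<Rightarrow> real) \<Rightarrow> vec \<Rightarrow> real" where
  "Pobj n f R x = Fsum n f x + R x"

section \<open>The algorithms, with cost accounting\<close>

text \<open>
  Each procedure is a probabilistic program whose result carries the accumulated cost of the
  charged operations, the price of one operation being given by \<open>cost\<close>.
\<close>

datatype oper = Grad_Eval | Prox_Eval | Vec_Op

definition theta :: "nat \<Rightarrow> real" where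
  "theta k = (real k + 1) / 2"

definition vr_gradient ::
  "nat \<Rightarrow> nat \<Rightarrow> (nat \<Rightarrow> vec \<Rightarrow> real) \<Rightarrow> (nat \<Rightarrow> real) \<Rightarrow> nat \<Rightarrow> vec \<Rightarrow> vec \<Rightarrow> nat list \<Rightarrow> vec" where
  "vr_gradient d n f L b xtil y I =
     (1 / real b) *\<^sub>R
       (\<Sum>i\<leftarrow>I. (1 / (real n * qprob n L i)) *\<^sub>R (grad d (f i) y - grad d (f i) xtil))
     + grad d (Fsum n f) xtil"

text \<open>Full gradient: \<open>n\<close> component gradients, \<open>n - 1\<close> additions and one scaling.\<close>

definition full_grad_cost :: "(oper \<Rightarrow> real) \<Rightarrow> nat \<Rightarrow> real" where
  "full_grad_cost cost n = real n * cost Grad_Eval + real n * cost Vec_Op"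

text \<open>
  Inner iteration: per sampled index two gradients, a subtraction, a scaling and an accumulation;
  then \<open>2\<close> further vector operations for \<open>g\<close>, \<open>3\<close> each for \<open>y\<close>, \<open>gbar\<close> and \<open>x\<close>, and for \<open>z\<close> a
  scaling, a subtraction and one proximal mapping.
\<close>

definition inner_iter_cost :: "(oper \<Rightarrow> real) \<Rightarrow> nat \<Rightarrow> real" where
  "inner_iter_cost cost b =
     real b * (2 * cost Grad_Eval + 3 * cost Vec_Op) + 13 * cost Vec_Op + cost Prox_Eval"

text \<open>State after \<open>k\<close> inner iterations: the vectors \<open>x\<close>, \<open>z\<close>, \<open>gbar\<close> and the cost so far.\<close>

primrec acc_svrda_iter ::
  "(oper \<Rightarrow> real) \<Rightarrow> nat \<Rightarrow> nat \<Rightarrow> (nat \<Rightarrow> vec \<Rightarrow> real) \<Rightarrow> (nat \<Rightarrow> real) \<Rightarrow> (vec \<Rightarrow> real) \<Rightarrow>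
   vec \<Rightarrow> vec \<Rightarrow> real \<Rightarrow> nat \<Rightarrow> nat \<Rightarrow> (vec \<times> vec \<times> vec \<times> real) pmf" where
  "acc_svrda_iter cost d n f L R ytil xtil \<eta> b 0 =
     return_pmf (ytil, ytil, 0, full_grad_cost cost n)"
| "acc_svrda_iter cost d n f L R ytil xtil \<eta> b (Suc k) =
     do {
       (x, z, gbar, c) \<leftarrow> acc_svrda_iter cost d n f L R ytil xtil \<eta> b k;
       I \<leftarrow> replicate_pmf b (Qdist n L);
       let t = theta (Suc k);
       let a = \<eta> * t * theta k;
       let y = (1 - 1 / t) *\<^sub>R x + (1 / t) *\<^sub>R z;
       let g = vr_gradient d n f L b xtil y I;
       let gbar' = (1 - 1 / t) *\<^sub>R gbar + (1 / t) *\<^sub>R g;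
       let z' = prox d (\<lambda>u. a * R u) (ytil - a *\<^sub>R gbar');
       let x' = (1 - 1 / t) *\<^sub>R x + (1 / t) *\<^sub>R z';
       return_pmf (x', z', gbar', c + inner_iter_cost cost b)
     }"

text \<open>The proximal step is the regularized dual averaging step.\<close>

lemma prox_eq_dual_averaging:
  assumes "a > 0"
  shows "prox d (\<lambda>u. a * R u) (z0 - a *\<^sub>R g) =
    arg_min (\<lambda>z. inner g z + R z + 1 / (2 * a) * (norm (z - z0))\<^sup>2) (\<lambda>z. z \<in> Rd d)"
proof -
  have expand: "1 / 2 * (norm (z - (z0 - a *\<^sub>R g)))\<^sup>2 + a * R z =
      a * (inner g z + R z + 1 / (2 * a) * (norm (z - z0))\<^sup>2)
      + (a\<^sup>2 / 2 * inner g g - a * inner g z0)" for z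
  proof -
    let ?w = "z - z0"
    have "(norm (?w + a *\<^sub>R g))\<^sup>2 = (norm ?w)\<^sup>2 + 2 * inner ?w (a *\<^sub>R g) + (norm (a *\<^sub>R g))\<^sup>2"
      using dot_norm[of ?w "a *\<^sub>R g"] by (simp add: field_simps)
    moreover have "inner ?w (a *\<^sub>R g) = a * (inner g z - inner g z0)"
      by (simp add: inner_diff_left inner_commute[of z g] inner_commute[of z0 g])
    moreover have "(norm (a *\<^sub>R g))\<^sup>2 = a\<^sup>2 * inner g g"
      by (simp add: power_mult_distrib flip: power2_norm_eq_inner)
    moreover have "z - (z0 - a *\<^sub>R g) = ?w + a *\<^sub>R g" by simp
    ultimately have N: "(norm (z - (z0 - a *\<^sub>R g)))\<^sup>2 =
        (norm ?w)\<^sup>2 + 2 * (a * (inner g z - inner g z0)) + a\<^sup>2 * inner g g"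
      by (simp only:)
    have "a * (1 / (2 * a) * (norm ?w)\<^sup>2) = (norm ?w)\<^sup>2 / 2"
      using assms by simp
    then show ?thesis
      unfolding N by (simp only: distrib_left) (simp add: algebra_simps)
  qed
  have "(1 / 2 * (norm (u - (z0 - a *\<^sub>R g)))\<^sup>2 + a * R u
        < 1 / 2 * (norm (v - (z0 - a *\<^sub>R g)))\<^sup>2 + a * R v) \<longleftrightarrow>
      (inner g u + R u + 1 / (2 * a) * (norm (u - z0))\<^sup>2
        < inner g v + R v + 1 / (2 * a) * (norm (v - z0))\<^sup>2)" for u v
    unfolding expand using assms by simp
  then show ?thesis
    unfolding prox_def arg_min_def is_arg_min_def by simp
qed

definition one_stage_acc_svrda ::
  "(oper \<Rightarrow> real) \<Rightarrow> nat \<Rightarrow> nat \<Rightarrow> (nat \<Rightarrow> vec \<Rightarrow> real) \<Rightarrow> (nat \<Rightarrow> real) \<Rightarrow> (vec \<Rightarrow> real) \<Rightarrow>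
   vec \<Rightarrow> vec \<Rightarrow> real \<Rightarrow> nat \<Rightarrow> nat \<Rightarrow> (vec \<times> vec \<times> real) pmf" where
  "one_stage_acc_svrda cost d n f L R ytil xtil \<eta> m b =
     map_pmf (\<lambda>(x, z, gbar, c). (x, z, c)) (acc_svrda_iter cost d n f L R ytil xtil \<eta> b m)"

definition step_size :: "nat \<Rightarrow> (nat \<Rightarrow> real) \<Rightarrow> real \<Rightarrow> nat \<Rightarrow> nat \<Rightarrow> real" where
  "step_size n L \<gamma> m b = 1 / ((1 + \<gamma> * (real m + 1) / real b) * Lbar n L)"

definition theta_outer :: "real \<Rightarrow> nat \<Rightarrow> real" where
  "theta_outer \<gamma> s = (1 - 1 / \<gamma>) * (real s + 2) / 2"

text \<open>
  State after \<open>s\<close> stages: the current and the previous \<open>x\<close>, the current \<open>z\<close> and the cost so far.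
  Extrapolation to the next starting point takes six vector operations.
\<close>

primrec dasvrda_ns_iter ::
  "(oper \<Rightarrow> real) \<Rightarrow> nat \<Rightarrow> nat \<Rightarrow> (nat \<Rightarrow> vec \<Rightarrow> real) \<Rightarrow> (nat \<Rightarrow> real) \<Rightarrow> (vec \<Rightarrow> real) \<Rightarrow>
   vec \<Rightarrow> vec \<Rightarrow> real \<Rightarrow> nat \<Rightarrow> nat \<Rightarrow> nat \<Rightarrow> (vec \<times> vec \<times> vec \<times> real) pmf" where
  "dasvrda_ns_iter cost d n f L R x0 z0 \<gamma> m b 0 = return_pmf (x0, z0, z0, 0)"
| "dasvrda_ns_iter cost d n f L R x0 z0 \<gamma> m b (Suc s) =
     do {
       (x, xprev, z, c) \<leftarrow> dasvrda_ns_iter cost d n f L R x0 z0 \<gamma> m b s;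
       let t = theta_outer \<gamma> (Suc s);
       let t' = theta_outer \<gamma> s;
       let y = x + ((t' - 1) / t) *\<^sub>R (x - xprev) + (t' / t) *\<^sub>R (z - x);
       (x', z', c') \<leftarrow> one_stage_acc_svrda cost d n f L R y x (step_size n L \<gamma> m b) m b;
       return_pmf (x', x, z', c + 6 * cost Vec_Op + c')
     }"

definition dasvrda_ns ::
  "(oper \<Rightarrow> real) \<Rightarrow> nat \<Rightarrow> nat \<Rightarrow> (nat \<Rightarrow> vec \<Rightarrow> real) \<Rightarrow> (nat \<Rightarrow> real) \<Rightarrow> (vec \<Rightarrow> real) \<Rightarrow>
   vec \<Rightarrow> vec \<Rightarrow> real \<Rightarrow> nat \<Rightarrow> nat \<Rightarrow> nat \<Rightarrow> (vec \<times> real) pmf" where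
  "dasvrda_ns cost d n f L R x0 z0 \<gamma> m b S =
     map_pmf (\<lambda>(x, xprev, z, c). (x, c)) (dasvrda_ns_iter cost d n f L R x0 z0 \<gamma> m b S)"

primrec dasvrda_sc ::
  "(oper \<Rightarrow> real) \<Rightarrow> nat \<Rightarrow> nat \<Rightarrow> (nat \<Rightarrow> vec \<Rightarrow> real) \<Rightarrow> (nat \<Rightarrow> real) \<Rightarrow> (vec \<Rightarrow> real) \<Rightarrow>
   vec \<Rightarrow> real \<Rightarrow> nat \<Rightarrow> nat \<Rightarrow> nat \<Rightarrow> nat \<Rightarrow> (vec \<times> real) pmf" where
  "dasvrda_sc cost d n f L R x0 \<gamma> m b S 0 = return_pmf (x0, 0)"
| "dasvrda_sc cost d n f L R x0 \<gamma> m b S (Suc t) =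
     do {
       (x, c) \<leftarrow> dasvrda_sc cost d n f L R x0 \<gamma> m b S t;
       (x', c') \<leftarrow> dasvrda_ns cost d n f L R x x \<gamma> m b S;
       return_pmf (x', c + c')
     }"

section \<open>Parameters of the restarted method\<close>

definition gamma_star :: "nat \<Rightarrow> nat \<Rightarrow> real" where
  "gamma_star m b = 1 / 2 * (3 + sqrt (9 + 8 * real b / (real m + 1)))"

definition rho :: "real \<Rightarrow> real \<Rightarrow> real \<Rightarrow> nat \<Rightarrow> nat \<Rightarrow> real" where
  "rho \<gamma> \<eta> \<mu> m S =
     4 * ((1 - 1 / \<gamma>)\<^sup>2 + 4 / (\<eta> * (real m + 1) * real m * \<mu>)) /
     ((1 - 1 / \<gamma>)\<^sup>2 * (real S + 2)\<^sup>2)"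

end

theory Submission
  imports Defs
begin

text \<open>
  The inner loop is Nesterov's accelerated dual averaging with an inexact gradient. Relative to a
  comparator \<open>u\<close>, the difference between \<open>A\<^sub>k P(x\<^sub>k)\<close> and the value of the dual averaging
  objective at its minimizer \<open>z\<^sub>k\<close> grows per iteration by at most the weighted value at \<open>u\<close> of the
  linearization of \<open>F\<close> at \<open>y\<^sub>k\<close>, plus noise (\<open>stage_potential_step\<close>). The noise term linear in the
  gradient error has mean zero. The quadratic one is controlled by the variance of the reduced
  gradient, which under importance sampling is at most \<open>Lbar / b\<close> times the weighted distance
  \<open>grad_gap\<close> between the component gradients at \<open>y\<^sub>k\<close> and at the snapshot
  (\<open>vr_gradient_variance\<close>).

  Half of such a distance also bounds the slack of the linearization from below, because each
  component is smooth and convex (\<open>smooth_convex_lower_bound\<close>). This is what lets the noise be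
  absorbed: the comparator is a convex combination, with weight \<open>\<tau>\<close> on the minimizer, of the
  snapshot and the minimizer, the linearization has slack towards both, and a triangle inequality
  transfers it to the pair (\<open>y\<^sub>k\<close>, snapshot) at the price of \<open>\<tau> / \<gamma>\<close> times the suboptimality of
  the snapshot (\<open>linearization_bound\<close>). So a stage reduces the gap of the snapshot to the fraction
  \<open>1 - \<tau> + \<tau> / \<gamma>\<close>, up to a difference of squared distances (\<open>one_stage_progress\<close>).

  With \<open>\<tau>\<close> the inverse of the outer parameter and the prescribed extrapolation these squared
  distances telescope over the stages, and the outer parameters grow slowly enough for their
  squares to absorb that fraction (\<open>outer_potential_expected_step\<close>). Optimal strong convexity
  bounds the initial squared distance by a multiple of the initial gap, so \<open>S\<close> stages contract the
  expected gap by the factor \<open>rho\<close> (\<open>dasvrda_ns_contraction\<close>), and \<open>T\<close> restarts by its \<open>T\<close>-th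
  power.

  What remains is arithmetic: \<open>1 / (\<eta> m (m + 1) \<mu>)\<close> is at most of the order of the square of
  \<open>(b / n + 1 / sqrt n) sqrt (Lbar / \<mu>)\<close> (\<open>inverse_step_size_bound\<close>), so a number of stages
  proportional to one plus this last quantity makes \<open>rho\<close> at most \<open>1 / 4\<close>. The cost of a run is
  deterministic.

  The vectors form an incomplete inner product space, so no vector-valued integral is used: all
  expectations are real, and unbiasedness is expressed by inner products. All distributions have
  finite support, so neither measurability nor integrability is an issue. The proximal step is
  defined by a choice of minimizer, and that a minimizer exists is proved from finite dimension.
\<close>

section \<open>Smooth convex functions on a subspace\<close>

text \<open>
  Derivatives are taken within a subspace. Restricting to lines that stay inside it reduces every
  claim about them to a function of one real variable.
\<close>

lemma along_line_has_real_derivative: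
  fixes f :: "'a::real_inner \<Rightarrow> real"
  assumes V: "subspace V" and x: "x \<in> V" and w: "w \<in> V"
    and D: "(f has_derivative (\<lambda>h. inner g h)) (at (x + t *\<^sub>R w) within V)"
  shows "((\<lambda>t. f (x + t *\<^sub>R w)) has_real_derivative inner g w) (at t)"
proof -
  have line: "((\<lambda>t. x + t *\<^sub>R w) has_derivative (\<lambda>s. s *\<^sub>R w)) (at t within UNIV)"
    by (auto intro!: derivative_eq_intros)
  have sub: "(\<lambda>t. x + t *\<^sub>R w) ` UNIV \<subseteq> V"
    using V x w by (auto intro: subspace_add subspace_scale)
  have "((\<lambda>t. f (x + t *\<^sub>R w)) has_derivative (\<lambda>s. inner g (s *\<^sub>R w))) (at t within UNIV)"
    by (rule has_derivative_in_compose[OF line has_derivative_subset[OF D sub]])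
  moreover have "(\<lambda>s. inner g (s *\<^sub>R w)) = (*) (inner g w)"
    by (simp add: fun_eq_iff mult.commute)
  ultimately show ?thesis
    by (simp only: has_field_derivative_def)
qed

lemma gradient_unique:
  fixes f :: "'a::real_inner \<Rightarrow> real"
  assumes V: "subspace V" and x: "x \<in> V" and g: "g \<in> V" "g' \<in> V"
    and D: "(f has_derivative (\<lambda>h. inner g h)) (at x within V)"
    and D': "(f has_derivative (\<lambda>h. inner g' h)) (at x within V)"
  shows "g = g'"
proof -
  have "inner g w = inner g' w" if w: "w \<in> V" for w
    using along_line_has_real_derivative[OF V x w, of f g 0]
      along_line_has_real_derivative[OF V x w, of f g' 0] D D' DERIV_unique by fastforce
  then have "inner (g - g') (g - g') = 0"
    using V g by (simp add: inner_diff_left subspace_diff)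
  then show ?thesis by simp
qed

lemma convex_on_above_tangent:
  fixes f :: "'a::real_inner \<Rightarrow> real"
  assumes V: "subspace V" and x: "x \<in> V" and y: "y \<in> V" and "convex_on V f"
    and D: "(f has_derivative (\<lambda>h. inner g h)) (at x within V)"
  shows "f x + inner g (y - x) \<le> f y"
proof -
  let ?w = "y - x"
  let ?h = "\<lambda>t. f (x + t *\<^sub>R ?w)"
  have w: "?w \<in> V" using V x y by (simp add: subspace_diff)
  have mem: "x + t *\<^sub>R ?w \<in> V" for t using V x w by (simp add: subspace_add subspace_scale)
  have "convex_on UNIV ?h"
  proof
    fix t a b :: real assume "t > 0" "t < 1"
    have "x + ((1 - t) *\<^sub>R a + t *\<^sub>R b) *\<^sub>R ?w =
        (1 - t) *\<^sub>R (x + a *\<^sub>R ?w) + t *\<^sub>R (x + b *\<^sub>R ?w)"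
      by (simp add: algebra_simps)
    then show "?h ((1 - t) *\<^sub>R a + t *\<^sub>R b) \<le> (1 - t) * ?h a + t * ?h b"
      using convex_onD[OF assms(4), of t] mem \<open>t > 0\<close> \<open>t < 1\<close> by simp
  qed simp
  from convex_on_imp_above_tangent[OF this, of 0 1 "inner g ?w"]
    along_line_has_real_derivative[OF V x w, of f g 0] D
  show ?thesis by simp
qed

text \<open>
  Along the segment from \<open>x\<close> to \<open>y\<close>, the function minus the claimed quadratic has nonpositive
  derivative, by Cauchy-Schwarz and the Lipschitz bound.
\<close>

lemma smooth_upper_bound:
  fixes f :: "'a::real_inner \<Rightarrow> real"
  assumes V: "subspace V" and x: "x \<in> V" and y: "y \<in> V"
    and D: "\<And>x. x \<in> V \<Longrightarrow> (f has_derivative (\<lambda>h. inner (g x) h)) (at x within V)"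
    and lip: "L-lipschitz_on V g"
  shows "f y \<le> f x + inner (g x) (y - x) + L / 2 * (norm (y - x))\<^sup>2"
proof -
  let ?w = "y - x"
  let ?h = "\<lambda>t. f (x + t *\<^sub>R ?w) - inner (g x) ?w * t - L / 2 * (norm ?w)\<^sup>2 * t\<^sup>2"
  have w: "?w \<in> V" using V x y by (simp add: subspace_diff)
  have mem: "x + t *\<^sub>R ?w \<in> V" for t using V x w by (simp add: subspace_add subspace_scale)
  have deriv: "(?h has_real_derivative
      (inner (g (x + t *\<^sub>R ?w)) ?w - inner (g x) ?w - L * (norm ?w)\<^sup>2 * t)) (at t)" for t
    by (rule derivative_eq_intros along_line_has_real_derivative[OF V x w D[OF mem]] refl)+ simp
  have neg: "inner (g (x + t *\<^sub>R ?w)) ?w - inner (g x) ?w - L * (norm ?w)\<^sup>2 * t \<le> 0"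
    if "0 \<le> t" for t
  proof -
    have "inner (g (x + t *\<^sub>R ?w) - g x) ?w \<le> norm (g (x + t *\<^sub>R ?w) - g x) * norm ?w"
      by (rule norm_cauchy_schwarz)
    also have "\<dots> \<le> (L * norm (t *\<^sub>R ?w)) * norm ?w"
      using lipschitz_onD[OF lip mem[of t] x] by (intro mult_right_mono) (auto simp: dist_norm)
    also have "\<dots> = L * (norm ?w)\<^sup>2 * t"
      using that by (simp add: power2_eq_square)
    finally show ?thesis by (simp add: inner_diff_left)
  qed
  have "?h 1 \<le> ?h 0"
    using DERIV_nonpos_imp_nonincreasing[of 0 1 ?h] deriv neg by force
  then show ?thesis by simp
qed

text \<open>
  Convexity alone gives the tangent bound. The gain comes from evaluating the tangent at \<open>x\<close> not
  in \<open>y\<close> but at the gradient step \<open>v\<close> from \<open>y\<close> for the function with that tangent subtracted; the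
  upper bound at \<open>y\<close> says how much this step decreases it.
\<close>

lemma smooth_convex_lower_bound:
  fixes f :: "'a::real_inner \<Rightarrow> real"
  assumes V: "subspace V" and x: "x \<in> V" and y: "y \<in> V" and cvx: "convex_on V f"
    and D: "\<And>x. x \<in> V \<Longrightarrow> (f has_derivative (\<lambda>h. inner (g x) h)) (at x within V)"
    and gV: "\<And>x. x \<in> V \<Longrightarrow> g x \<in> V"
    and lip: "L-lipschitz_on V g" and L: "L > 0"
  shows "f x + inner (g x) (y - x) + (norm (g y - g x))\<^sup>2 / (2 * L) \<le> f y"
proof -
  let ?r = "g y - g x"
  (* the minimizer of the quadratic upper bound at y, minus the tangent at x *)
  define v where "v = y - (1 / L) *\<^sub>R ?r"
  have v: "v \<in> V" using V y gV x by (simp add: v_def subspace_diff subspace_scale)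
  have 1: "f x + inner (g x) (v - x) \<le> f v"
    by (rule convex_on_above_tangent[OF V x v cvx D[OF x]])
  have 2: "f v \<le> f y + inner (g y) (v - y) + L / 2 * (norm (v - y))\<^sup>2"
    by (rule smooth_upper_bound[OF V y v D lip])
  have vy: "v - y = - (1 / L) *\<^sub>R ?r" by (simp add: v_def)
  have vx: "v - x = (y - x) + (v - y)" by simp
  have n: "L / 2 * (norm (v - y))\<^sup>2 = (norm ?r)\<^sup>2 / (2 * L)"
    unfolding vy norm_scaleR using L by (simp add: power2_eq_square)
  have "inner ?r (v - y) = - (norm ?r)\<^sup>2 / L"
    unfolding vy by (simp only: inner_scaleR_right power2_norm_eq_inner) simp
  then have i: "inner (g y) (v - y) - inner (g x) (v - y) = - (norm ?r)\<^sup>2 / L"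
    by (simp add: inner_diff_left)
  have "inner (g x) (v - x) = inner (g x) (y - x) + inner (g x) (v - y)"
    by (subst vx) (rule inner_add_right)
  with 1 2 n i show ?thesis
    by (simp add: field_simps)
qed

text \<open>
  The prox-objective is strongly convex, hence grows quadratically from its minimizer. The
  comparison with the point at fraction \<open>t\<close> of the way to \<open>v\<close> gives the claim with the factor
  \<open>1 - t\<close>, which disappears in the limit.
\<close>

lemma quadratic_growth_of_minimizer:
  fixes h :: "'a::real_inner \<Rightarrow> real"
  assumes V: "subspace V" and cvx: "convex_on V h" and v: "v \<in> V" and z: "z \<in> V" and a: "a > 0"
    and min: "\<And>u. u \<in> V \<Longrightarrow>
      h z + (norm (z - c))\<^sup>2 / (2 * a) \<le> h u + (norm (u - c))\<^sup>2 / (2 * a)"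
  shows "h z + (norm (z - c))\<^sup>2 / (2 * a) + (norm (v - z))\<^sup>2 / (2 * a)
    \<le> h v + (norm (v - c))\<^sup>2 / (2 * a)"
proof -
  let ?p = "\<lambda>u. h u + (norm (u - c))\<^sup>2 / (2 * a)"
  let ?N = "(norm (v - z))\<^sup>2 / (2 * a)"
  have bound: "?p z + (1 - t) * ?N \<le> ?p v" if t: "0 < t" "t < 1" for t
  proof -
    let ?u = "(1 - t) *\<^sub>R z + t *\<^sub>R v"
    have u: "?u \<in> V" using V v z by (simp add: subspace_add subspace_scale)
    have hu: "h ?u \<le> (1 - t) * h z + t * h v"
      using convex_onD[OF cvx, of t z v] v z t by simp
    have "?u - c = (1 - t) *\<^sub>R (z - c) + t *\<^sub>R (v - c)" by (simp add: algebra_simps)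
    moreover have "v - z = (v - c) - (z - c)" by simp
    ultimately have nu: "(norm (?u - c))\<^sup>2 =
        (1 - t) * (norm (z - c))\<^sup>2 + t * (norm (v - c))\<^sup>2 - t * (1 - t) * (norm (v - z))\<^sup>2"
      by (simp only: power2_norm_eq_inner)
        (simp add: inner_add_left inner_add_right inner_diff_left inner_diff_right inner_commute
          algebra_simps)
    have nu': "(norm (?u - c))\<^sup>2 / (2 * a) = (1 - t) * ((norm (z - c))\<^sup>2 / (2 * a))
        + t * ((norm (v - c))\<^sup>2 / (2 * a)) - t * (1 - t) * ?N"
      unfolding nu by (simp only: add_divide_distrib diff_divide_distrib times_divide_eq_right)
    have combine: "p + q \<le> (1 - t) * (A + Z) + t * (B + W) - t * (1 - t) * N"
      if "p \<le> (1 - t) * A + t * B" "q = (1 - t) * Z + t * W - t * (1 - t) * N"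
      for p q A B Z W N :: real
      using that by (simp add: algebra_simps)
    have "?p z \<le> ?p ?u" by (rule min[OF u])
    also have "\<dots> \<le> (1 - t) * ?p z + t * ?p v - t * (1 - t) * ?N"
      by (rule combine[OF hu nu'])
    finally have "?p z \<le> (1 - t) * ?p z + t * ?p v - t * (1 - t) * ?N" .
    moreover have "p + (1 - t) * N \<le> q" if "p \<le> (1 - t) * p + t * q - t * (1 - t) * N" for p q N
    proof -
      have "t * (p + (1 - t) * N) \<le> t * q" using that by (simp add: algebra_simps)
      then show ?thesis using t by simp
    qed
    ultimately show ?thesis by blast
  qed
  have lim: "((\<lambda>t. ?p z + (1 - t) * ?N) \<longlongrightarrow> ?p z + (1 - 0) * ?N) (at_right 0)"
    by (intro tendsto_intros)
  have ev: "\<forall>\<^sub>F t in at_right (0::real). ?p z + (1 - t) * ?N \<le> ?p v"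
    using eventually_at_right_real[of 0 "1::real"] by (rule eventually_mono) (use bound in auto)
  have "?p z + (1 - 0) * ?N \<le> ?p v"
    by (rule tendsto_upperbound[OF lim ev]) simp
  then show ?thesis by simp
qed

section \<open>Convex functions and gradients in finite dimension\<close>

lemma basis_in_Rd: "i < d \<Longrightarrow> Poly_Mapping.single i 1 \<in> Rd d"
  by (auto simp: Rd_def lookup_single when_def)

lemma lookup_sum_basis:
  fixes k d :: nat
  shows "Poly_Mapping.lookup (\<Sum>i<d. c i *\<^sub>R Poly_Mapping.single i (1::real)) k
      = (if k < d then c k else 0)"
  by (simp add: lookup_sum lookup_scaleR lookup_single when_def if_distrib[of "(*) _"] cong:
      if_cong)

lemma sum_basis_in_Rd: "(\<Sum>i<d. c i *\<^sub>R Poly_Mapping.single i (1::real)) \<in> Rd d"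
  by (simp add: Rd_def lookup_sum_basis)

lemma Rd_basis_expansion:
  assumes "x \<in> Rd d"
  shows "x = (\<Sum>i<d. Poly_Mapping.lookup x i *\<^sub>R Poly_Mapping.single i 1)"
  using assms by (intro poly_mapping_eqI) (auto simp: lookup_sum_basis Rd_def)

lemma abs_lookup_le_norm:
  assumes "x \<in> Rd d" "i < d"
  shows "\<bar>Poly_Mapping.lookup x i\<bar> \<le> norm x"
proof -
  have "(Poly_Mapping.lookup x i)\<^sup>2 \<le> (\<Sum>i<d. (Poly_Mapping.lookup x i)\<^sup>2)"
    using assms(2) by (intro member_le_sum) auto
  then show ?thesis
    by (simp add: norm_Rd[OF assms(1)] real_le_rsqrt)
qed

text \<open>
  The whole space of finitely supported sequences is not complete; its coordinate subspaces are,
  and a limit is found coordinatewise.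
\<close>

lemma Cauchy_in_Rd_converges:
  fixes X :: "nat \<Rightarrow> vec"
  assumes X: "\<forall>n. X n \<in> Rd d" and C: "Cauchy X"
  shows "\<exists>l\<in>Rd d. X \<longlonglongrightarrow> l"
proof -
  let ?c = "\<lambda>n i. Poly_Mapping.lookup (X n) i"
  have "convergent (\<lambda>n. ?c n i)" if i: "i < d" for i
  proof (rule Cauchy_convergent, rule metric_CauchyI)
    fix e :: real assume "e > 0"
    from metric_CauchyD[OF C this] obtain M where M: "\<forall>m\<ge>M. \<forall>n\<ge>M. dist (X m) (X n) < e" by blast
    have "dist (?c m i) (?c n i) \<le> dist (X m) (X n)" for m n
      using abs_lookup_le_norm[OF
          subspace_diff[OF subspace_Rd X[rule_format, of m] X[rule_format, of n]] i]
      by (simp add: dist_norm lookup_minus)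
    with M show "\<exists>M. \<forall>m\<ge>M. \<forall>n\<ge>M. dist (?c m i) (?c n i) < e" by (meson le_less_trans)
  qed
  then obtain l where l: "\<And>i. i < d \<Longrightarrow> (\<lambda>n. ?c n i) \<longlonglongrightarrow> l i"
    unfolding convergent_def by metis
  define z :: vec where "z = (\<Sum>i<d. l i *\<^sub>R Poly_Mapping.single i 1)"
  have z: "z \<in> Rd d" unfolding z_def by (rule sum_basis_in_Rd)
  have n: "norm (X n - z) = sqrt (\<Sum>i<d. (?c n i - l i)\<^sup>2)" for n
    using norm_Rd[OF subspace_diff[OF subspace_Rd X[rule_format, of n] z]]
    by (simp add: lookup_minus z_def lookup_sum_basis)
  have "(\<lambda>n. sqrt (\<Sum>i<d. (?c n i - l i)\<^sup>2)) \<longlonglongrightarrow> sqrt (\<Sum>i<d. (l i - l i)\<^sup>2)"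
    by (intro tendsto_intros l) auto
  then have "(\<lambda>n. norm (X n - z)) \<longlonglongrightarrow> 0" by (simp add: n)
  then have "X \<longlonglongrightarrow> z"
    using LIM_zero_cancel tendsto_norm_zero_iff by blast
  with z show "\<exists>l\<in>Rd d. X \<longlonglongrightarrow> l" by blast
qed

text \<open>
  This replaces continuity and subgradients of a convex function: it gives both lower
  semicontinuity at \<open>y\<close> and a lower bound that a quadratic dominates. If \<open>x - y\<close> has coordinates
  \<open>c\<^sub>i\<close> with absolute sum \<open>s\<close>, then \<open>y\<close> is the convex combination of \<open>x\<close> and the points
  \<open>y - sgn c\<^sub>i e\<^sub>i\<close> with weights \<open>1 / (1 + s)\<close> and \<open>\<bar>c\<^sub>i\<bar> / (1 + s)\<close>, and Jensen's inequality
  bounds \<open>R x\<close> from below in terms of the values of \<open>R\<close> at these finitely many points.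
\<close>

lemma convex_on_Rd_lower_cone:
  assumes cvx: "convex_on (Rd d) R" and y: "y \<in> Rd d"
  shows "\<exists>K\<ge>0. \<forall>x\<in>Rd d. R y - K * norm (x - y) \<le> R x"
proof -
  let ?e = "\<lambda>i. Poly_Mapping.single i (1::real)"
  (* an upper bound for R at y and at all its axis neighbours, since sgn 0 = 0 *)
  define M where "M = (\<Sum>i<d. \<bar>R (y + ?e i)\<bar> + \<bar>R (y - ?e i)\<bar>) + \<bar>R y\<bar>"
  have M: "R (y - sgn c *\<^sub>R ?e i) \<le> M" if "i < d" for i and c :: real
  proof -
    have "R (y - sgn c *\<^sub>R ?e i) \<le> \<bar>R (y + ?e i)\<bar> + \<bar>R (y - ?e i)\<bar> + \<bar>R y\<bar>"
      by (auto simp: sgn_if)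
    also have "\<dots> \<le> M"
      unfolding M_def using that by (intro add_right_mono member_le_sum) auto
    finally show ?thesis .
  qed
  have My: "R y \<le> M" unfolding M_def by (smt (verit) sum_nonneg)
  have "R y - (real d * (M - R y)) * norm (x - y) \<le> R x" if x: "x \<in> Rd d" for x
  proof -
    define u where "u = x - y"
    have u: "u \<in> Rd d" unfolding u_def by (rule subspace_diff[OF subspace_Rd x y])
    let ?c = "\<lambda>i. Poly_Mapping.lookup u i"
    define s where "s = (\<Sum>i<d. \<bar>?c i\<bar>)"
    have s0: "s \<ge> 0" unfolding s_def by (simp add: sum_nonneg)
    define a where "a = (\<lambda>i. (if i < d then \<bar>?c i\<bar> else 1) / (1 + s))"
    define p where "p = (\<lambda>i. if i < d then y - sgn (?c i) *\<^sub>R ?e i else x)"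
    have S: "{..d} = insert d {..<d}" by auto
    have sum_a: "(\<Sum>i\<in>{..d}. a i) = 1"
      unfolding S using s0 by (simp add: a_def sum_divide_distrib[symmetric] s_def[symmetric]
          add_divide_distrib[symmetric])
    have pm: "p i \<in> Rd d" for i
      unfolding p_def using x y
      by (auto intro!: subspace_diff[OF subspace_Rd] subspace_scale[OF subspace_Rd] basis_in_Rd)
    have "(\<Sum>i\<in>{..d}. a i *\<^sub>R p i)
        = (1 / (1 + s)) *\<^sub>R x + (\<Sum>i<d. (1 / (1 + s)) *\<^sub>R (\<bar>?c i\<bar> *\<^sub>R y - ?c i *\<^sub>R ?e i))"
      unfolding S
      by (auto simp: a_def p_def scaleR_diff_right abs_mult_sgn mult.commute intro!: sum.cong)
    also have "\<dots> = (1 / (1 + s)) *\<^sub>R (x + (s *\<^sub>R y - u))"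
      unfolding scaleR_sum_right[symmetric] scaleR_add_right
      by (simp add: sum_subtractf s_def scaleR_left.sum flip: Rd_basis_expansion[OF u])
    also have "x + (s *\<^sub>R y - u) = (1 + s) *\<^sub>R y"
      by (simp add: u_def algebra_simps)
    finally have comb: "(\<Sum>i\<in>{..d}. a i *\<^sub>R p i) = y"
      using s0 by simp
    have "R y \<le> (\<Sum>i\<in>{..d}. a i * R (p i))"
      using convex_on_sum[OF _ _ cvx sum_a, of p] pm s0 unfolding comb by (auto simp: a_def)
    also have "\<dots> = R x / (1 + s) + (\<Sum>i<d. \<bar>?c i\<bar> / (1 + s) * R (p i))"
      unfolding S by (simp add: a_def p_def)
    also have "\<dots> \<le> R x / (1 + s) + (\<Sum>i<d. \<bar>?c i\<bar> / (1 + s) * M)"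
      using s0 M by (intro add_left_mono sum_mono mult_left_mono) (auto simp: p_def)
    also have "\<dots> = (R x + s * M) / (1 + s)"
      by (simp add: s_def add_divide_distrib sum_distrib_right sum_divide_distrib)
    finally have "R y * (1 + s) \<le> R x + s * M"
      using s0 by (simp add: field_simps)
    then have 1: "R y - s * (M - R y) \<le> R x" by (simp add: algebra_simps)
    have "s \<le> (\<Sum>i<d. norm u)" unfolding s_def by (intro sum_mono abs_lookup_le_norm[OF u]) simp
    then have "s * (M - R y) \<le> (real d * norm u) * (M - R y)"
      using My by (intro mult_right_mono) auto
    with 1 show ?thesis by (simp add: u_def algebra_simps)
  qed
  moreover have "real d * (M - R y) \<ge> 0" using My by simp
  ultimately show ?thesis by blast
qed

text \<open>
  A minimizing sequence is Cauchy, since by the parallelogram law two almost optimal points at a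
  positive distance would have a midpoint with value below the infimum. The cone bound at the
  limit shows that the limit attains the infimum.
\<close>

lemma strongly_convex_attains_minimum:
  assumes cvx: "convex_on (Rd d) h" and c: "c \<in> Rd d" and a: "a > 0"
  shows "\<exists>z\<in>Rd d. \<forall>u\<in>Rd d. h z + (norm (z - c))\<^sup>2 / (2 * a) \<le> h u + (norm (u - c))\<^sup>2 / (2 * a)"
proof -
  define p where "p = (\<lambda>u. h u + (norm (u - c))\<^sup>2 / (2 * a))"
  note V = subspace_Rd
  obtain K where K: "K \<ge> 0" "\<And>x. x \<in> Rd d \<Longrightarrow> h c - K * norm (x - c) \<le> h x"
    using convex_on_Rd_lower_cone[OF cvx c] by blast
  have low: "h c - a * K\<^sup>2 / 2 \<le> p x" if "x \<in> Rd d" for x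
  proof -
    have "0 \<le> (norm (x - c) - a * K)\<^sup>2 / (2 * a)" using a by simp
    also have "\<dots> = (norm (x - c))\<^sup>2 / (2 * a) - K * norm (x - c) + a * K\<^sup>2 / 2"
      using a by (simp add: power2_eq_square field_simps)
    finally show ?thesis using K(2)[OF that] by (simp add: p_def)
  qed
  define I where "I = (INF x\<in>Rd d. p x)"
  have bdd: "bdd_below (p ` Rd d)" using low by (auto intro!: bdd_belowI2)
  have I: "I \<le> p x" if "x \<in> Rd d" for x unfolding I_def by (rule cINF_lower[OF bdd that])
  have "\<exists>x\<in>Rd d. p x < I + 1 / (real n + 1)" for n
  proof -
    have "(INF x\<in>Rd d. p x) < I + 1 / (real n + 1)" unfolding I_def[symmetric] by simp
    then show ?thesis using cINF_less_iff[OF _ bdd] c by blast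
  qed
  then obtain X where X: "\<And>n. X n \<in> Rd d" "\<And>n. p (X n) < I + 1 / (real n + 1)" by metis
  have mid: "(norm (u - v))\<^sup>2
      \<le> 8 * a * ((p u + p v) / 2 - I)" if u: "u \<in> Rd d" and v: "v \<in> Rd d" for u v
  proof -
    let ?w = "(1 - 1/2) *\<^sub>R u + (1 / 2) *\<^sub>R v"
    have w: "?w \<in> Rd d" using u v by (intro subspace_add[OF V] subspace_scale[OF V])
    have hw: "h ?w \<le> (1 - 1/2) * h u + 1 / 2 * h v"
      using convex_onD[OF cvx, of "1/2" u v] u v by simp
    have parallelogram: "(norm (p + q))\<^sup>2 / 4
        = (norm p)\<^sup>2 / 2 + (norm q)\<^sup>2 / 2 - (norm (p - q))\<^sup>2 / 4" for p q :: vec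
      by (simp only: power2_norm_eq_inner)
        (simp add: inner_add_left inner_add_right inner_diff_left inner_diff_right
          inner_commute[of q p] add_divide_distrib diff_divide_distrib)
    have "?w - c = (1 / 2) *\<^sub>R ((u - c) + (v - c))"
      by (rule poly_mapping_eqI, simp only: lookup_add lookup_minus lookup_scaleR)
        (simp add: field_simps)
    then have "(norm (?w - c))\<^sup>2 = (norm ((u - c) + (v - c)))\<^sup>2 / 4"
      by (simp add: power_divide)
    also have "\<dots> = (norm (u - c))\<^sup>2 / 2 + (norm (v - c))\<^sup>2 / 2 - (norm ((u - c) - (v - c)))\<^sup>2 / 4"
      by (rule parallelogram)
    finally have nw: "(norm (?w - c))\<^sup>2
        = (norm (u - c))\<^sup>2 / 2 + (norm (v - c))\<^sup>2 / 2 - (norm (u - v))\<^sup>2 / 4"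
      by simp
    have "(norm (?w - c))\<^sup>2 / (2 * a) = (norm (u - c))\<^sup>2 / (2 * a) / 2
        + (norm (v - c))\<^sup>2 / (2 * a) / 2 - (norm (u - v))\<^sup>2 / (8 * a)"
      unfolding nw by (simp add: add_divide_distrib diff_divide_distrib)
    with I[OF w] hw have "(norm (u - v))\<^sup>2 / (8 * a) \<le> (p u + p v) / 2 - I"
      unfolding p_def by (simp add: field_simps)
    then show ?thesis using a by (simp add: field_simps)
  qed
  have average: "(r + s) / 2 - I \<le> q" if "r < I + q" "s < I + q" for r s q :: real
    using that by (simp add: field_simps)
  have "Cauchy X"
  proof (rule metric_CauchyI)
    fix e :: real assume e: "e > 0"
    obtain N :: nat where N: "8 * a / e\<^sup>2 < real N" using reals_Archimedean2 by blast
    have "dist (X m) (X n) < e" if "m \<ge> N" "n \<ge> N" for m n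
    proof -
      have tol: "1 / (real k + 1) \<le> 1 / (real N + 1)" if "k \<ge> N" for k
        using that by (simp add: field_simps)
      have "(p (X m) + p (X n)) / 2 - I \<le> 1 / (real N + 1)"
        by (rule average[OF order_less_le_trans[OF X(2)[of m] add_left_mono[OF tol[OF that(1)]]]
          order_less_le_trans[OF X(2)[of n] add_left_mono[OF tol[OF that(2)]]]])
      then have "(norm (X m - X n))\<^sup>2 \<le> 8 * a * (1 / (real N + 1))"
        using mid[OF X(1) X(1), of m n] a by (smt (verit, best) mult_left_mono)
      also have "\<dots> < e\<^sup>2"
      proof -
        have "8 * a < real N * e\<^sup>2" using N e by (simp add: field_simps)
        also have "\<dots> \<le> (real N + 1) * e\<^sup>2" by (simp add: mult_right_mono)
        finally show ?thesis by (simp add: field_simps)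
      qed
      finally show ?thesis using e by (simp add: dist_norm power2_less_imp_less)
    qed
    then show "\<exists>M. \<forall>m\<ge>M. \<forall>n\<ge>M. dist (X m) (X n) < e" by blast
  qed
  then obtain z where z: "z \<in> Rd d" and lim: "X \<longlonglongrightarrow> z"
    using Cauchy_in_Rd_converges X(1) by blast
  obtain K' where K': "K' \<ge> 0" "\<And>x. x \<in> Rd d \<Longrightarrow> h z - K' * norm (x - z) \<le> h x"
    using convex_on_Rd_lower_cone[OF cvx z] by blast
  have "(\<lambda>n. I + 1 / (real n + 1)) \<longlonglongrightarrow> I + 0"
    by (intro tendsto_add tendsto_const)
        (use LIMSEQ_inverse_real_of_nat in \<open>simp add: inverse_eq_divide add.commute\<close>)
  moreover have "(\<lambda>n. h z - K' * norm (X n - z) + (norm (X n - c))\<^sup>2 / (2 * a))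
      \<longlonglongrightarrow> h z - K' * norm (z - z) + (norm (z - c))\<^sup>2 / (2 * a)"
    using a by (intro tendsto_intros lim) auto
  moreover have "h z - K' * norm (X n - z) + (norm (X n - c))\<^sup>2 / (2 * a)
      \<le> I + 1 / (real n + 1)" for n
    using X(2)[of n] K'(2)[OF X(1), of n] unfolding p_def by linarith
  ultimately have "p z \<le> I"
    unfolding p_def using LIMSEQ_le by fastforce
  with z I show ?thesis unfolding p_def by (meson order_trans)
qed

text \<open>
  The operator \<open>prox\<close> picks an arbitrary minimizer; existence turns this choice into an optimality
  property.
\<close>

lemma dual_averaging_step:
  fixes R :: "vec \<Rightarrow> real" and g c :: vec
  assumes cvx: "convex_on (Rd d) R" and c: "c \<in> Rd d" and a: "a > 0"
  defines "z \<equiv> prox d (\<lambda>u. a * R u) (c - a *\<^sub>R g)"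
  shows "z \<in> Rd d"
    and "v \<in> Rd d \<Longrightarrow> inner g z + R z + (norm (z - c))\<^sup>2 / (2 * a) + (norm (v - z))\<^sup>2 / (2 * a)
      \<le> inner g v + R v + (norm (v - c))\<^sup>2 / (2 * a)"
proof -
  let ?h = "\<lambda>u. inner g u + R u"
  let ?p = "\<lambda>u. inner g u + R u + 1 / (2 * a) * (norm (u - c))\<^sup>2"
  have cvx_h: "convex_on (Rd d) ?h"
    by (intro convex_on_add cvx)
        (auto intro!: convex_onI simp: inner_add_right subspace_imp_convex[OF subspace_Rd])
  obtain w where w: "w \<in> Rd d" "\<And>u. u \<in> Rd d \<Longrightarrow> ?p w \<le> ?p u"
    using strongly_convex_attains_minimum[OF cvx_h c a] by auto
  have "is_arg_min ?p (\<lambda>u. u \<in> Rd d) w"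
    using w by (auto simp: is_arg_min_linorder)
  then have "is_arg_min ?p (\<lambda>u. u \<in> Rd d) z"
    unfolding z_def prox_eq_dual_averaging[OF a] arg_min_def by (rule someI)
  then have z: "z \<in> Rd d" "\<And>u. u \<in> Rd d \<Longrightarrow> ?p z \<le> ?p u"
    by (auto simp: is_arg_min_linorder)
  show "z \<in> Rd d" by (rule z)
  show "inner g z + R z + (norm (z - c))\<^sup>2 / (2 * a) + (norm (v - z))\<^sup>2 / (2 * a)
      \<le> inner g v + R v + (norm (v - c))\<^sup>2 / (2 * a)" if v: "v \<in> Rd d"
    by (rule quadratic_growth_of_minimizer[OF subspace_Rd cvx_h v z(1) a]) (use z(2) in auto)
qed

text \<open>
  A derivative within \<open>Rd d\<close> is a linear form on the whole space, but only its values on the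
  subspace matter, and there it is represented by the vector of its values on the unit vectors.
\<close>

lemma grad_properties:
  assumes diff: "f differentiable_on Rd d" and x: "x \<in> Rd d"
  shows "grad d f x \<in> Rd d"
    and "(f has_derivative (\<lambda>h. inner (grad d f x) h)) (at x within Rd d)"
proof -
  obtain D where D: "(f has_derivative D) (at x within Rd d)"
    using diff x unfolding differentiable_on_def differentiable_def by blast
  interpret D: bounded_linear D by (rule has_derivative_bounded_linear[OF D])
  define g :: vec where "g = (\<Sum>i<d. D (Poly_Mapping.single i 1) *\<^sub>R Poly_Mapping.single i 1)"
  have g: "g \<in> Rd d" unfolding g_def by (rule sum_basis_in_Rd)
  have Dg: "D h = inner g h" if h: "h \<in> Rd d" for h
  proof -
    have "D h = (\<Sum>i<d. Poly_Mapping.lookup h i * D (Poly_Mapping.single i 1))"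
      by (subst Rd_basis_expansion[OF h]) (simp add: D.sum D.scaleR)
    also have "\<dots> = inner g h"
      unfolding inner_Rd[OF g] by (simp add: g_def lookup_sum_basis mult.commute)
    finally show ?thesis .
  qed
  have hd: "(f has_derivative (\<lambda>h. inner g h)) (at x within Rd d)"
  proof (rule has_derivativeI_sandwich[where e = 1])
    show "((\<lambda>y. norm ((f y - f x) - D (y - x)) / norm (y - x)) \<longlongrightarrow> 0) (at x within Rd d)"
      using D by (simp add: has_derivative_iff_norm)
  qed (use Dg x in \<open>auto intro: bounded_linear_inner_right simp: subspace_diff[OF subspace_Rd]\<close>)
  have "\<exists>!g. g \<in> Rd d \<and> (f has_derivative (\<lambda>h. inner g h)) (at x within Rd d)"
    using g hd gradient_unique[OF subspace_Rd x] by blast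
  from theI'[OF this, folded grad_def]
  show "grad d f x \<in> Rd d" "(f has_derivative (\<lambda>h. inner (grad d f x) h)) (at x within Rd d)"
    by auto
qed

lemma grad_eqI:
  assumes "x \<in> Rd d" "g \<in> Rd d" "(f has_derivative (\<lambda>h. inner g h)) (at x within Rd d)"
  shows "grad d f x = g"
  unfolding grad_def using assms gradient_unique[OF subspace_Rd assms(1)]
  by (intro the_equality) auto

section \<open>Sampling with finite support\<close>

lemma expectation_bind_finite:
  fixes h :: "'b \<Rightarrow> real"
  assumes "finite (set_pmf p)" "\<And>x. x \<in> set_pmf p \<Longrightarrow> finite (set_pmf (f x))"
  shows "measure_pmf.expectation (p \<bind> f) h
    = measure_pmf.expectation p (\<lambda>x. measure_pmf.expectation (f x) h)"
  using assms
  by (subst pmf_expectation_bind[of "set_pmf p"])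
    (auto simp: integral_measure_pmf_real[of "set_pmf p"] mult.commute)

lemma expectation_mono_finite:
  fixes h k :: "'a \<Rightarrow> real"
  assumes "finite (set_pmf p)" "\<And>x. x \<in> set_pmf p \<Longrightarrow> h x \<le> k x"
  shows "measure_pmf.expectation p h \<le> measure_pmf.expectation p k"
  using assms by (intro integral_mono_AE)
      (auto simp: AE_measure_pmf_iff integrable_measure_pmf_finite)

lemma finite_set_replicate_pmf: "finite (set_pmf p) \<Longrightarrow> finite (set_pmf (replicate_pmf b p))"
  by (induction b) auto

text \<open>
  Inner products with an arbitrary \<open>w\<close> stand for the vector-valued mean. That \<open>w\<close> is arbitrary is
  used in the variance lemma, where it is one of the summands.
\<close>

lemma replicate_pmf_centered_mean:
  fixes X :: "'i \<Rightarrow> 'a::real_inner"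
  assumes fin: "finite (set_pmf p)"
    and centered: "\<And>w. measure_pmf.expectation p (\<lambda>i. inner (X i) w) = 0"
  shows "measure_pmf.expectation (replicate_pmf b p) (\<lambda>I. inner (\<Sum>i\<leftarrow>I. X i) w) = 0"
proof (induction b)
  case (Suc b)
  note fin' = finite_set_replicate_pmf[OF fin]
  note [simp] = integrable_measure_pmf_finite[OF fin] integrable_measure_pmf_finite[OF fin']
  show ?case
    using fin fin' by (simp add: expectation_bind_finite inner_add_left Suc centered)
qed simp

lemma replicate_pmf_centered_variance:
  fixes X :: "'i \<Rightarrow> 'a::real_inner"
  assumes fin: "finite (set_pmf p)"
    and centered: "\<And>w. measure_pmf.expectation p (\<lambda>i. inner (X i) w) = 0"
  shows "measure_pmf.expectation (replicate_pmf b p) (\<lambda>I. (norm (\<Sum>i\<leftarrow>I. X i))\<^sup>2)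
    = real b * measure_pmf.expectation p (\<lambda>i. (norm (X i))\<^sup>2)"
proof (induction b)
  case (Suc b)
  note fin' = finite_set_replicate_pmf[OF fin]
  note [simp] = integrable_measure_pmf_finite[OF fin] integrable_measure_pmf_finite[OF fin']
  have expand: "(norm (u + v))\<^sup>2 = (norm u)\<^sup>2 + 2 * inner v u + (norm v)\<^sup>2" for u v :: 'a
    by (simp add: power2_norm_eq_inner inner_add_left inner_add_right inner_commute)
  show ?case
    using fin fin'
    by (simp add: expectation_bind_finite expand Suc replicate_pmf_centered_mean[OF fin centered]
        algebra_simps)
qed simp

section \<open>The composite problem and its variance-reduced gradient\<close>

locale composite_problem =
  fixes d n :: nat and f :: "nat \<Rightarrow> vec \<Rightarrow> real" and L :: "nat \<Rightarrow> real" and R :: "vec \<Rightarrow> real"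
    and xs :: vec
  assumes n_pos: "1 \<le> n"
    and convex_f: "i \<in> {1..n} \<Longrightarrow> convex_on (Rd d) (f i)"
    and diff_f: "i \<in> {1..n} \<Longrightarrow> f i differentiable_on Rd d"
    and L_pos: "i \<in> {1..n} \<Longrightarrow> 0 < L i"
    and lipschitz_grad: "i \<in> {1..n} \<Longrightarrow> (L i)-lipschitz_on (Rd d) (grad d (f i))"
    and convex_R: "convex_on (Rd d) R"
    and minimizer_xs: "minimizer d (Pobj n f R) xs"
begin

abbreviation "F \<equiv> Fsum n f"
abbreviation "P \<equiv> Pobj n f R"
abbreviation "Lb \<equiv> Lbar n L"
abbreviation "gF \<equiv> grad d F"

text \<open>
  With the weights \<open>1 / L i\<close> this quantity does two things: half of it is a lower bound for the
  Bregman divergence of \<open>F\<close>, and under importance sampling a multiple of it bounds the variance.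
\<close>

definition grad_gap :: "vec \<Rightarrow> vec \<Rightarrow> real" where
  "grad_gap x y = (\<Sum>i=1..n. (norm (grad d (f i) x - grad d (f i) y))\<^sup>2 / L i) / real n"

lemma xs_in_Rd: "xs \<in> Rd d"
  and P_min: "x \<in> Rd d \<Longrightarrow> P xs \<le> P x"
  using minimizer_xs by (auto simp: minimizer_def is_arg_min_linorder)

lemma sum_L_pos: "(\<Sum>i=1..n. L i) > 0"
  using n_pos by (intro sum_pos L_pos) auto

lemma Lb_pos: "Lb > 0"
  using sum_L_pos n_pos by (simp add: Lbar_def)

lemma Fsum_has_derivative:
  assumes x: "x \<in> Rd d"
  shows "(F has_derivative (\<lambda>h. inner ((1 / real n) *\<^sub>R (\<Sum>i=1..n. grad d (f i) x)) h))
      (at x within Rd d)"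
proof -
  have "((\<lambda>x. (1 / real n) * (\<Sum>i=1..n. f i x)) has_derivative
      (\<lambda>h. (1 / real n) * (\<Sum>i=1..n. inner (grad d (f i) x) h))) (at x within Rd d)"
    by (intro has_derivative_mult_right has_derivative_sum grad_properties(2) diff_f x)
  then show ?thesis
    by (simp add: Fsum_def[abs_def] inner_sum_left)
qed

lemma grad_Fsum:
  assumes "x \<in> Rd d"
  shows "gF x = (1 / real n) *\<^sub>R (\<Sum>i=1..n. grad d (f i) x)"
  using assms Fsum_has_derivative[OF assms]
  by (intro grad_eqI subspace_scale[OF subspace_Rd] subspace_sum[OF subspace_Rd]
      grad_properties(1) diff_f)

lemma inner_grad_Fsum:
  assumes "x \<in> Rd d"
  shows "inner (gF x) w = (\<Sum>i=1..n. inner (grad d (f i) x) w) / real n"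
  by (simp add: grad_Fsum[OF assms] inner_sum_left)

lemma Fsum_upper_bound:
  assumes x: "x \<in> Rd d" and y: "y \<in> Rd d"
  shows "F y \<le> F x + inner (gF x) (y - x) + Lb / 2 * (norm (y - x))\<^sup>2"
proof -
  have "(\<Sum>i=1..n. f i y) \<le> (\<Sum>i=1..n. f i x + inner (grad d (f i) x) (y - x) + L i / 2 *
      (norm (y - x))\<^sup>2)"
    by (intro sum_mono smooth_upper_bound[OF subspace_Rd x y] grad_properties(2) diff_f
        lipschitz_grad)
  then have "(\<Sum>i=1..n. f i y) / real n
      \<le> (\<Sum>i=1..n. f i x + inner (grad d (f i) x) (y - x) + L i / 2 * (norm (y - x))\<^sup>2) / real n"
    by (rule divide_right_mono) simp
  then show ?thesis
    by (simp add: Fsum_def inner_grad_Fsum[OF x] Lbar_def sum.distrib add_divide_distrib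
        sum_divide_distrib[symmetric] sum_distrib_right[symmetric])
qed

lemma Fsum_lower_bound:
  assumes x: "x \<in> Rd d" and y: "y \<in> Rd d"
  shows "F x + inner (gF x) (y - x) + grad_gap y x / 2 \<le> F y"
proof -
  have "(\<Sum>i=1..n. f i x + inner (grad d (f i) x) (y - x)
        + (norm (grad d (f i) y - grad d (f i) x))\<^sup>2 / (2 * L i)) \<le> (\<Sum>i=1..n. f i y)"
    by (intro sum_mono smooth_convex_lower_bound[OF subspace_Rd x y convex_f] grad_properties diff_f
        lipschitz_grad L_pos)
  then have "(\<Sum>i=1..n. f i x + inner (grad d (f i) x) (y - x)
        + (norm (grad d (f i) y - grad d (f i) x))\<^sup>2 / L i / 2) / real n
            \<le> (\<Sum>i=1..n. f i y) / real n"
    by (intro divide_right_mono) (auto simp: mult.commute)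
  also have "(\<Sum>i=1..n. f i x + inner (grad d (f i) x) (y - x)
        + (norm (grad d (f i) y - grad d (f i) x))\<^sup>2 / L i / 2) / real n
      = F x + inner (gF x) (y - x) + grad_gap y x / 2"
    unfolding sum.distrib sum_divide_distrib[where r = 2, symmetric]
    by (simp add: Fsum_def inner_grad_Fsum[OF x] grad_gap_def add_divide_distrib mult.commute)
  finally show ?thesis by (simp add: Fsum_def)
qed

lemma grad_gap_nonneg: "0 \<le> grad_gap x y"
  unfolding grad_gap_def by (intro divide_nonneg_nonneg sum_nonneg less_imp_le[OF L_pos]) auto

text \<open>
  First-order optimality for a nondifferentiable \<open>R\<close>: move from the minimizer to \<open>x\<close> by the
  fraction \<open>t\<close>, bound \<open>R\<close> by convexity and \<open>F\<close> by smoothness, divide by \<open>t\<close>, and let \<open>t\<close> tend to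
  \<open>0\<close>.
\<close>

lemma minimizer_optimality:
  assumes x: "x \<in> Rd d"
  shows "R xs \<le> R x + inner (gF xs) (x - xs)"
proof -
  let ?w = "x - xs"
  have bound: "0 \<le> R x - R xs + inner (gF xs) ?w + t * (Lb / 2 * (norm ?w)\<^sup>2)"
      if t: "0 < t" "t < 1" for t
  proof -
    let ?u = "(1 - t) *\<^sub>R xs + t *\<^sub>R x"
    have u: "?u \<in> Rd d"
      using x xs_in_Rd by (intro subspace_add[OF subspace_Rd] subspace_scale[OF subspace_Rd])
    have uw: "?u - xs = t *\<^sub>R ?w" by (simp add: algebra_simps)
    have 1: "F xs + R xs \<le> F ?u + R ?u" using P_min[OF u] by (simp add: Pobj_def)
    have 2: "R ?u \<le> (1 - t) * R xs + t * R x"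
      using convex_onD[OF convex_R, of t xs x] x xs_in_Rd t by simp
    have 3: "F ?u \<le> F xs + t * inner (gF xs) ?w + Lb / 2 * (t * norm ?w)\<^sup>2"
      using Fsum_upper_bound[OF xs_in_Rd u] t unfolding uw by simp
    have "0 \<le> t * (R x - R xs + inner (gF xs) ?w + t * (Lb / 2 * (norm ?w)\<^sup>2))"
      using 1 2 3 by (simp add: algebra_simps power2_eq_square)
    then show ?thesis using t by (simp add: zero_le_mult_iff)
  qed
  have lim: "((\<lambda>t. R x - R xs + inner (gF xs) ?w + t * (Lb / 2 * (norm ?w)\<^sup>2))
      \<longlongrightarrow> R x - R xs + inner (gF xs) ?w + 0 * (Lb / 2 * (norm ?w)\<^sup>2)) (at_right 0)"
    by (intro tendsto_intros)
  have ev: "\<forall>\<^sub>F t in at_right 0. 0 \<le> R x - R xs + inner (gF xs) ?w + t * (Lb / 2 * (norm ?w)\<^sup>2)"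
    using eventually_at_right_real[of 0 "1::real"] by (rule eventually_mono) (use bound in auto)
  have "0 \<le> R x - R xs + inner (gF xs) ?w + 0 * (Lb / 2 * (norm ?w)\<^sup>2)"
    by (rule tendsto_lowerbound[OF lim ev]) simp
  then show ?thesis by simp
qed

lemma grad_gap_minimizer:
  assumes x: "x \<in> Rd d"
  shows "grad_gap x xs \<le> 2 * (P x - P xs)"
  using Fsum_lower_bound[OF xs_in_Rd x] minimizer_optimality[OF x] by (simp add: Pobj_def)

text \<open>
  The triangle inequality for a weighted Euclidean norm, squared with unequal weights: the
  constant in front of the gap between \<open>x\<close> and \<open>z\<close> can be made small at the price of a factor
  \<open>c + 1\<close> on the left.
\<close>

lemma grad_gap_triangle:
  assumes c: "c > 0"
  shows "grad_gap y x / (c + 1) \<le> grad_gap z y + grad_gap x z / c"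
proof -
  have term_bound: "(norm (p - q))\<^sup>2 / (c + 1)
      \<le> (norm (r - p))\<^sup>2 + (norm (q - r))\<^sup>2 / c" for p q r :: vec
  proof -
    let ?a = "norm (r - p)" and ?b = "norm (q - r)"
    have "norm (p - q) \<le> ?a + ?b"
      using norm_triangle_ineq[of "r - p" "q - r"] by (simp add: norm_minus_commute)
    then have "(norm (p - q))\<^sup>2 \<le> (?a + ?b)\<^sup>2" by (simp add: power_mono)
    moreover have "0 \<le> (c * ?a - ?b)\<^sup>2" by simp
    ultimately have "c * (norm (p - q))\<^sup>2 \<le> (c + 1) * (c * ?a\<^sup>2 + ?b\<^sup>2)"
    proof -
      have "c * (norm (p - q))\<^sup>2 \<le> c * (?a + ?b)\<^sup>2"
        using c \<open>(norm (p - q))\<^sup>2 \<le> (?a + ?b)\<^sup>2\<close> by simp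
      also have "\<dots> = (c + 1) * (c * ?a\<^sup>2 + ?b\<^sup>2) - (c * ?a - ?b)\<^sup>2"
        by (simp add: power2_eq_square algebra_simps)
      finally show ?thesis using \<open>0 \<le> (c * ?a - ?b)\<^sup>2\<close> by linarith
    qed
    then show ?thesis using c by (simp add: field_simps)
  qed
  have "(\<Sum>i=1..n. (norm (grad d (f i) y - grad d (f i) x))\<^sup>2 / (c + 1) / L i)
      \<le> (\<Sum>i=1..n. ((norm (grad d (f i) z - grad d (f i) y))\<^sup>2
            + (norm (grad d (f i) x - grad d (f i) z))\<^sup>2 / c) / L i)"
    by (intro sum_mono divide_right_mono term_bound less_imp_le[OF L_pos])
  then have "(\<Sum>i=1..n. (norm (grad d (f i) y - grad d (f i) x))\<^sup>2 / L i / (c + 1))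
      \<le> (\<Sum>i=1..n. (norm (grad d (f i) z - grad d (f i) y))\<^sup>2 / L i
            + (norm (grad d (f i) x - grad d (f i) z))\<^sup>2 / L i / c)"
    by (simp add: add_divide_distrib mult.commute)
  then have "(\<Sum>i=1..n. (norm (grad d (f i) y - grad d (f i) x))\<^sup>2 / L i) / (c + 1)
      \<le> (\<Sum>i=1..n. (norm (grad d (f i) z - grad d (f i) y))\<^sup>2 / L i)
            + (\<Sum>i=1..n. (norm (grad d (f i) x - grad d (f i) z))\<^sup>2 / L i) / c"
    by (simp add: sum.distrib sum_divide_distrib)
  from divide_right_mono[OF this, of "real n"] show ?thesis
    by (simp add: grad_gap_def add_divide_distrib mult.commute)
qed

abbreviation "Q \<equiv> Qdist n L"

lemma pmf_Qdist: "pmf Q i = (if i \<in> {1..n} then qprob n L i else 0)"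
  unfolding Qdist_def
proof (rule pmf_embed_pmf)
  have q: "0 \<le> qprob n L i" if "i \<in> {1..n}" for i
    using that L_pos[of i] Lb_pos by (simp add: qprob_def)
  then show "0 \<le> (if i \<in> {1..n} then qprob n L i else 0)" for i by simp
  have "(\<integral>\<^sup>+ i. ennreal (if i \<in> {1..n} then qprob n L i else 0) \<partial>count_space UNIV)
      = (\<Sum>i\<in>{1..n}. ennreal (if i \<in> {1..n} then qprob n L i else 0))"
    by (rule nn_integral_count_space') auto
  also have "\<dots> = ennreal (\<Sum>i=1..n. qprob n L i)"
    by (subst sum_ennreal[symmetric]) (use q in \<open>auto intro!: sum.cong\<close>)
  also have "(\<Sum>i=1..n. qprob n L i) = 1"
    using sum_L_pos n_pos by (simp add: qprob_def Lbar_def sum_divide_distrib[symmetric])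
  finally show "(\<integral>\<^sup>+ i. ennreal (if i \<in> {1..n} then qprob n L i else 0) \<partial>count_space UNIV) = 1"
    by simp
qed

lemma set_pmf_Qdist: "set_pmf Q \<subseteq> {1..n}"
  by (auto simp: set_pmf_eq pmf_Qdist split: if_splits)

lemma finite_set_pmf_Qdist: "finite (set_pmf Q)"
  using finite_subset[OF set_pmf_Qdist] by simp

lemma expectation_Qdist:
  "measure_pmf.expectation Q h = (\<Sum>i=1..n. L i / (real n * Lb) * h i)" for h :: "nat \<Rightarrow> real"
proof -
  have "measure_pmf.expectation Q h = (\<Sum>i\<in>{1..n}. h i * pmf Q i)"
    by (rule integral_measure_pmf_real) (use set_pmf_Qdist in auto)
  then show ?thesis by (simp add: pmf_Qdist qprob_def mult.commute)
qed

lemma inverse_n_qprob: "i \<in> {1..n} \<Longrightarrow> 1 / (real n * qprob n L i) = Lb / L i"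
  using n_pos by (simp add: qprob_def)

context
  fixes xt y :: vec and b :: nat
  assumes xt: "xt \<in> Rd d" and y: "y \<in> Rd d" and b: "1 \<le> b"
begin

definition sample_error :: "nat \<Rightarrow> vec" where
  "sample_error i = (1 / (real n * qprob n L i)) *\<^sub>R (grad d (f i) y - grad d (f i) xt) -
      (gF y - gF xt)"

lemma vr_gradient_error:
  assumes "I \<in> set_pmf (replicate_pmf b Q)"
  shows "vr_gradient d n f L b xt y I - gF y = (1 / real b) *\<^sub>R (\<Sum>i\<leftarrow>I. sample_error i)"
proof -
  have "(\<Sum>i\<leftarrow>I. sample_error i)
      = (\<Sum>i\<leftarrow>I. (1 / (real n * qprob n L i)) *\<^sub>R (grad d (f i) y - grad d (f i) xt))
      - real (length I) *\<^sub>R (gF y - gF xt)"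
    by (induction I) (auto simp: sample_error_def algebra_simps)
  moreover have "length I = b" using assms by (simp add: set_replicate_pmf)
  ultimately show ?thesis
    using b by (simp add: vr_gradient_def scaleR_diff_right)
qed

lemma expectation_scaled_difference:
  "measure_pmf.expectation Q
      (\<lambda>i. inner ((1 / (real n * qprob n L i)) *\<^sub>R (grad d (f i) y - grad d (f i) xt)) w)
    = inner (gF y - gF xt) w"
proof -
  have "measure_pmf.expectation Q
      (\<lambda>i. inner ((1 / (real n * qprob n L i)) *\<^sub>R (grad d (f i) y - grad d (f i) xt)) w)
     = (\<Sum>i=1..n. inner (grad d (f i) y - grad d (f i) xt) w / real n)"
    unfolding expectation_Qdist inner_scaleR_left
  proof (intro sum.cong refl)
    fix i assume i: "i \<in> {1..n}"
    show "L i / (real n * Lb) *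
        (1 / (real n * qprob n L i) * inner (grad d (f i) y - grad d (f i) xt) w)
      = inner (grad d (f i) y - grad d (f i) xt) w / real n"
      unfolding inverse_n_qprob[OF i] using L_pos[OF i] Lb_pos by simp
  qed
  then show ?thesis
    by (simp add: inner_diff_left inner_grad_Fsum xt y sum_subtractf diff_divide_distrib
        sum_divide_distrib)
qed

lemma sample_error_centered: "measure_pmf.expectation Q (\<lambda>i. inner (sample_error i) w) = 0"
  unfolding sample_error_def inner_diff_left[of "_ *\<^sub>R _"]
  by (subst Bochner_Integration.integral_diff)
    (simp_all add: integrable_measure_pmf_finite[OF finite_set_pmf_Qdist]
      expectation_scaled_difference del: inner_scaleR_left)

text \<open>
  The variance is at most the second moment. With sampling probabilities proportional to \<open>L i\<close>,
  one factor of the squared weights \<open>Lbar / L i\<close> cancels against the probability, up to \<open>1 / n\<close>.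
\<close>

lemma sample_error_variance:
  "measure_pmf.expectation Q (\<lambda>i. (norm (sample_error i))\<^sup>2) \<le> Lb * grad_gap y xt"
proof -
  let ?D = "\<lambda>i. (1 / (real n * qprob n L i)) *\<^sub>R (grad d (f i) y - grad d (f i) xt)"
  let ?M = "gF y - gF xt"
  note [simp] = integrable_measure_pmf_finite[OF finite_set_pmf_Qdist]
  have expand: "(norm (sample_error i))\<^sup>2
      = (norm (?D i))\<^sup>2 - 2 * inner (?D i) ?M + (norm ?M)\<^sup>2" for i
    unfolding sample_error_def power2_norm_eq_inner
    by (subst inner_diff_left, subst (1 2) inner_diff_right) (simp add: inner_commute)
  have linear: "measure_pmf.expectation Q (\<lambda>i. h i - 2 * k i + c)
      = measure_pmf.expectation Q h - 2 * measure_pmf.expectation Q k + c"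
          for h k :: "nat \<Rightarrow> real" and c
    by simp
  have "measure_pmf.expectation Q (\<lambda>i. (norm (sample_error i))\<^sup>2)
      = measure_pmf.expectation Q (\<lambda>i. (norm (?D i))\<^sup>2)
        - 2 * measure_pmf.expectation Q (\<lambda>i. inner (?D i) ?M) + (norm ?M)\<^sup>2"
    unfolding expand linear ..
  also have "\<dots> \<le> measure_pmf.expectation Q (\<lambda>i. (norm (?D i))\<^sup>2)"
    unfolding expectation_scaled_difference power2_norm_eq_inner[of ?M] by simp
  also have "\<dots> = (\<Sum>i=1..n. Lb * ((norm (grad d (f i) y - grad d (f i) xt))\<^sup>2 / L i / real n))"
    unfolding expectation_Qdist norm_scaleR
  proof (intro sum.cong refl)
    fix i assume i: "i \<in> {1..n}"
    show "L i / (real n * Lb) *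
        (\<bar>1 / (real n * qprob n L i)\<bar> * norm (grad d (f i) y - grad d (f i) xt))\<^sup>2
      = Lb * ((norm (grad d (f i) y - grad d (f i) xt))\<^sup>2 / L i / real n)"
      unfolding inverse_n_qprob[OF i] using L_pos[OF i] Lb_pos n_pos
      by (simp add: power2_eq_square field_simps)
  qed
  also have "\<dots> = Lb * grad_gap y xt"
    by (simp add: grad_gap_def sum_distrib_left sum_divide_distrib)
  finally show ?thesis .
qed

lemma vr_gradient_unbiased:
  "measure_pmf.expectation (replicate_pmf b Q) (\<lambda>I. inner (vr_gradient d n f L b xt y I - gF y) w)
      = 0"
proof -
  have "measure_pmf.expectation (replicate_pmf b Q)
      (\<lambda>I. inner (vr_gradient d n f L b xt y I - gF y) w)
      = measure_pmf.expectation (replicate_pmf b Q) (\<lambda>I. inner (\<Sum>i\<leftarrow>I. sample_error i) w / real b)"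
    by (intro integral_cong_AE) (auto simp: AE_measure_pmf_iff vr_gradient_error)
  then show ?thesis
    by (simp add: replicate_pmf_centered_mean[OF finite_set_pmf_Qdist sample_error_centered])
qed

lemma vr_gradient_variance:
  "measure_pmf.expectation (replicate_pmf b Q) (\<lambda>I. (norm (vr_gradient d n f L b xt y I - gF y))\<^sup>2)
    \<le> Lb / real b * grad_gap y xt"
proof -
  have "measure_pmf.expectation (replicate_pmf b Q)
      (\<lambda>I. (norm (vr_gradient d n f L b xt y I - gF y))\<^sup>2)
      = measure_pmf.expectation (replicate_pmf b Q)
          (\<lambda>I. (norm (\<Sum>i\<leftarrow>I. sample_error i))\<^sup>2 / (real b)\<^sup>2)"
    by (intro integral_cong_AE) (auto simp: AE_measure_pmf_iff vr_gradient_error power_divide)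
  also have "\<dots> = measure_pmf.expectation Q (\<lambda>i. (norm (sample_error i))\<^sup>2) / real b"
    using b by (simp add: replicate_pmf_centered_variance[OF finite_set_pmf_Qdist
        sample_error_centered] power2_eq_square[of "real b"])
  also have "\<dots> \<le> Lb * grad_gap y xt / real b"
    by (rule divide_right_mono[OF sample_error_variance]) simp
  finally show ?thesis by simp
qed

end

end

section \<open>One stage of accelerated dual averaging\<close>

text \<open>
  The product of consecutive \<open>theta\<close>. It is the total weight of the first \<open>k\<close> gradients, the
  \<open>k\<close>-th entering with \<open>theta (k - 1) = k / 2\<close>.
\<close>

definition weight :: "nat \<Rightarrow> real" where
  "weight k = real k * (real k + 1) / 4"

text \<open>
  The three averages of an iteration, for \<open>y\<close>, \<open>gbar\<close> and \<open>x\<close>, have these coefficients.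
\<close>

definition mix :: "nat \<Rightarrow> vec \<Rightarrow> vec \<Rightarrow> vec" where
  "mix k p q = (1 - 1 / theta (Suc k)) *\<^sub>R p + (1 / theta (Suc k)) *\<^sub>R q"

definition dual_step :: "nat \<Rightarrow> (vec \<Rightarrow> real) \<Rightarrow> real \<Rightarrow> vec \<Rightarrow> nat \<Rightarrow> vec \<Rightarrow> vec" where
  "dual_step d R \<eta> c k g =
     prox d (\<lambda>u. \<eta> * theta (Suc k) * theta k * R u) (c - (\<eta> * theta (Suc k) * theta k) *\<^sub>R g)"

lemma weight_nonneg: "0 \<le> weight k" and weight_Suc_pos: "0 < weight (Suc k)"
  by (simp_all add: weight_def)

lemma weight_Suc: "weight (Suc k) = weight k + (real k + 1) / 2"
  by (simp add: weight_def field_simps)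

lemma weight_theta: "theta (Suc k) * theta k = weight (Suc k)"
  by (simp add: weight_def theta_def)

lemma weight_mix_coefficients:
  "weight (Suc k) * (1 - 1 / theta (Suc k)) = weight k"
  "weight (Suc k) * (1 / theta (Suc k)) = (real k + 1) / 2"
  by (simp_all add: weight_def theta_def field_simps)

lemma weight_mix: "weight (Suc k) *\<^sub>R mix k p q = weight k *\<^sub>R p + ((real k + 1) / 2) *\<^sub>R q"
  unfolding mix_def scaleR_add_right scaleR_scaleR weight_mix_coefficients ..

lemma inner_mix:
  "weight (Suc k) * inner (mix k p q) v = weight k * inner p v + (real k + 1) / 2 * inner q v"
  using arg_cong[OF weight_mix[of k p q], of "\<lambda>w. inner w v"] by (simp add: inner_add_left)

lemma mix_in_Rd: "p \<in> Rd d \<Longrightarrow> q \<in> Rd d \<Longrightarrow> mix k p q \<in> Rd d"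
  unfolding mix_def by (intro subspace_add[OF subspace_Rd] subspace_scale[OF subspace_Rd])

lemma convex_on_mix:
  assumes "convex_on (Rd d) R" "p \<in> Rd d" "q \<in> Rd d"
  shows "weight (Suc k) * R (mix k p q) \<le> weight k * R p + (real k + 1) / 2 * R q"
proof -
  have "R (mix k p q) \<le> (1 - 1 / theta (Suc k)) * R p + 1 / theta (Suc k) * R q"
    unfolding mix_def using assms by (intro convex_onD[OF assms(1)]) (auto simp: theta_def)
  then have "weight (Suc k) * R (mix k p q)
      \<le> weight (Suc k) * ((1 - 1 / theta (Suc k)) * R p + 1 / theta (Suc k) * R q)"
    by (intro mult_left_mono) (simp_all add: weight_nonneg)
  also have "\<dots> = weight k * R p + (real k + 1) / 2 * R q"
    unfolding distrib_left mult.assoc[symmetric] weight_mix_coefficients ..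
  finally show ?thesis .
qed

lemma acc_svrda_iter_Suc_mix:
  "acc_svrda_iter cost d n f L R c xt \<eta> b (Suc k) =
     acc_svrda_iter cost d n f L R c xt \<eta> b k \<bind> (\<lambda>(x, z, gbar, e).
       replicate_pmf b (Qdist n L) \<bind> (\<lambda>I.
         let gbar' = mix k gbar (vr_gradient d n f L b xt (mix k x z) I);
             z' = dual_step d R \<eta> c k gbar'
         in return_pmf (mix k x z', z', gbar', e + inner_iter_cost cost b)))"
  by (simp add: Let_def mix_def dual_step_def)

text \<open>
  The function that the dual averaging step minimizes, times \<open>weight k\<close> and shifted by a constant.
  The shift makes the linear part vanish at the comparator \<open>u\<close>, so that the state of the algorithm
  determines the potential below and no past gradients have to be remembered.
\<close>

definition dual_objective :: "(vec \<Rightarrow> real) \<Rightarrow> real \<Rightarrow> vec \<Rightarrow> vec \<Rightarrow> nat \<Rightarrow> vec \<Rightarrow> vec \<Rightarrow> real" where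
  "dual_objective R \<eta> c u k g v = weight k * (inner g (v - u) + R v) + (norm (v - c))\<^sup>2 / (2 * \<eta>)"

lemma dual_objective_mix:
  "dual_objective R \<eta> c u (Suc k) (mix k gbar g) v
    = dual_objective R \<eta> c u k gbar v + (real k + 1) / 2 * (inner g (v - u) + R v)"
proof -
  have "weight (Suc k) * (inner (mix k gbar g) (v - u) + R v)
      = weight (Suc k) * inner (mix k gbar g) (v - u) + weight (Suc k) * R v"
    by (rule distrib_left)
  also have "\<dots> = weight k * (inner gbar (v - u) + R v) + (real k + 1) / 2 * (inner g (v - u) + R v)"
    unfolding inner_mix by (simp only: weight_Suc distrib_left distrib_right ac_simps)
  finally show ?thesis by (simp add: dual_objective_def)
qed

lemma dual_step_optimal:
  fixes R :: "vec \<Rightarrow> real" and k :: nat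
  assumes "convex_on (Rd d) R" "c \<in> Rd d" "\<eta> > 0"
  defines "z \<equiv> \<lambda>g. dual_step d R \<eta> c k g"
  shows "z g \<in> Rd d"
    and "v \<in> Rd d \<Longrightarrow> dual_objective R \<eta> c u (Suc k) g (z g) + (norm (v - z g))\<^sup>2 / (2 * \<eta>)
      \<le> dual_objective R \<eta> c u (Suc k) g v"
proof -
  let ?w = "weight (Suc k)"
  have z: "z g = prox d (\<lambda>u. \<eta> * ?w * R u) (c - (\<eta> * ?w) *\<^sub>R g)"
    by (simp add: z_def dual_step_def weight_theta mult.assoc)
  have pos: "\<eta> * ?w > 0" using assms(3) weight_Suc_pos by simp
  note step = dual_averaging_step[where g = g, OF assms(1,2) pos, folded z]
  show "z g \<in> Rd d" by (rule step)
  show "dual_objective R \<eta> c u (Suc k) g (z g) + (norm (v - z g))\<^sup>2 / (2 * \<eta>)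
      \<le> dual_objective R \<eta> c u (Suc k) g v" if "v \<in> Rd d"
  proof -
    have scale: "?w * (p / (2 * (\<eta> * ?w))) = p / (2 * \<eta>)" for p
      using weight_Suc_pos[of k] by simp
    have "?w * (inner g (z g) + R (z g) + (norm (z g - c))\<^sup>2 / (2 * (\<eta> * ?w)) +
        (norm (v - z g))\<^sup>2 / (2 * (\<eta> * ?w)))
        \<le> ?w * (inner g v + R v + (norm (v - c))\<^sup>2 / (2 * (\<eta> * ?w)))"
      using step(2)[OF that] by (intro mult_left_mono) (auto simp: weight_nonneg)
    then show ?thesis
      unfolding distrib_left scale dual_objective_def inner_diff_right
      by (simp add: algebra_simps)
  qed
qed

context composite_problem
begin

lemma finite_set_acc_svrda_iter: "finite (set_pmf (acc_svrda_iter cost d n f L R c xt \<eta> b k))"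
  by (induction k)
    (auto simp: acc_svrda_iter_Suc_mix Let_def finite_set_replicate_pmf finite_set_pmf_Qdist
      simp del: acc_svrda_iter.simps(2))

definition stage_invariant :: "real \<Rightarrow> vec \<Rightarrow> vec \<Rightarrow> nat \<Rightarrow> vec \<times> vec \<times> vec \<Rightarrow> bool" where
  "stage_invariant \<eta> c u k = (\<lambda>(x, z, gbar). x \<in> Rd d \<and> z \<in> Rd d \<and>
     (\<forall>v\<in>Rd d. dual_objective R \<eta> c u k gbar z + (norm (v - z))\<^sup>2 / (2 * \<eta>)
        \<le> dual_objective R \<eta> c u k gbar v))"

text \<open>
  The error term of an estimate-sequence argument, written as a function of the state alone so
  that its conditional expectation over one sample can be compared with its current value.
\<close>

definition stage_potential :: "real \<Rightarrow> vec \<Rightarrow> vec \<Rightarrow> nat \<Rightarrow> vec \<times> vec \<times> vec \<Rightarrow> real" where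
  "stage_potential \<eta> c u k = (\<lambda>(x, z, gbar). weight k * P x - dual_objective R \<eta> c u k gbar z)"

lemma stage_invariant_step:
  assumes "stage_invariant \<eta> c u k (x, z, gbar)" "c \<in> Rd d" "\<eta> > 0"
  shows "stage_invariant \<eta> c u (Suc k) (mix k x (dual_step d R \<eta> c k g), dual_step d R \<eta> c k g, g)"
  using assms dual_step_optimal[OF convex_R assms(2,3)]
  by (auto simp: stage_invariant_def mix_in_Rd)

lemma acc_svrda_iter_invariant:
  assumes "c \<in> Rd d" "\<eta> > 0" "(x, z, gbar, e) \<in> set_pmf (acc_svrda_iter cost d n f L R c xt \<eta> b k)"
  shows "stage_invariant \<eta> c u k (x, z, gbar)"
  using assms(3)
proof (induction k arbitrary: x z gbar e)
  case 0
  then show ?case using assms(1)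
    by (simp add: stage_invariant_def dual_objective_def weight_def)
next
  case (Suc k)
  then show ?case
    using stage_invariant_step[OF Suc.IH assms(1,2)]
    by (auto simp: acc_svrda_iter_Suc_mix Let_def simp del: acc_svrda_iter.simps(2))
qed

text \<open>
  One iteration for an arbitrary gradient estimate \<open>g\<close>. Smoothness of \<open>F\<close> in the short step from
  \<open>y\<close> to the new \<open>x\<close>, convexity of \<open>F\<close> between \<open>y\<close> and the old \<open>x\<close>, and convexity of \<open>R\<close> bound the
  new objective value, and the quadratic growth of the dual objective provides a negative square
  of the step \<open>w\<close> from the old to the new \<open>z\<close>. The step size is small enough to leave \<open>\<beta> / 2\<close>
  times this square, which pays by Young's inequality for the correlation of the gradient error
  with the step. The other error term is against \<open>z - u\<close>, known before sampling.
\<close>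

lemma stage_potential_step:
  fixes k :: nat and g :: vec
  assumes inv: "stage_invariant \<eta> c u k (x, z, gbar)" and c: "c \<in> Rd d" and \<eta>: "\<eta> > 0"
    and \<beta>: "\<beta> > 0" "\<beta> = 1 / \<eta> - Lb"
  defines "y \<equiv> mix k x z" and "a \<equiv> (real k + 1) / 2"
  defines "z' \<equiv> dual_step d R \<eta> c k (mix k gbar g)"
  shows "stage_potential \<eta> c u (Suc k) (mix k x z', z', mix k gbar g)
    \<le> stage_potential \<eta> c u k (x, z, gbar) + a * (F y + inner (gF y) (u - y))
      - a * inner (g - gF y) (z - u) + a\<^sup>2 / (2 * \<beta>) * (norm (g - gF y))\<^sup>2"
proof -
  let ?A = "weight k" and ?A' = "weight (Suc k)" and ?x' = "mix k x z'"
  have x: "x \<in> Rd d" and z: "z \<in> Rd d"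
    and dual: "\<And>v. v \<in> Rd d \<Longrightarrow> dual_objective R \<eta> c u k gbar z + (norm (v - z))\<^sup>2 / (2 * \<eta>)
        \<le> dual_objective R \<eta> c u k gbar v"
    using inv by (auto simp: stage_invariant_def)
  have z': "z' \<in> Rd d" unfolding z'_def by (rule dual_step_optimal(1)[OF convex_R c \<eta>])
  have y: "y \<in> Rd d" and x': "?x' \<in> Rd d" unfolding y_def by (auto intro: mix_in_Rd x z z')
  have A': "?A' = ?A + a" unfolding a_def by (rule weight_Suc)
  have a0: "a > 0" by (simp add: a_def)
  define w where "w = z' - z"
  let ?G = "gF y" and ?\<delta> = "g - gF y"
  have x'y: "?x' - y = (1 / theta (Suc k)) *\<^sub>R w"
    unfolding y_def w_def mix_def by (simp add: algebra_simps)
  have up: "?A' * F ?x' \<le> ?A' * F y + a * inner ?G w + Lb / 2 * (norm w)\<^sup>2"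
  proof -
    have "?A' * F ?x' \<le> ?A' * (F y + inner ?G (?x' - y) + Lb / 2 * (norm (?x' - y))\<^sup>2)"
      by (intro mult_left_mono Fsum_upper_bound y x') (simp add: weight_nonneg)
    also have "\<dots> = ?A' * F y + (?A' * (1 / theta (Suc k))) * inner ?G w
        + (?A' * (1 / theta (Suc k)) * (1 / theta (Suc k))) * (Lb / 2 * (norm w)\<^sup>2)"
      unfolding x'y by (simp add: power_mult_distrib power_divide distrib_left power2_eq_square)
    also have "\<dots> \<le> ?A' * F y + a * inner ?G w + 1 * (Lb / 2 * (norm w)\<^sup>2)"
      unfolding weight_mix_coefficients(2) a_def using Lb_pos
      by (intro add_mono mult_right_mono order_refl) (auto simp: theta_def field_simps)
    finally show ?thesis by simp
  qed
  have low: "?A * F y + a * inner ?G (y - z) \<le> ?A * F x"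
  proof -
    have "?A' *\<^sub>R y = ?A *\<^sub>R x + a *\<^sub>R z" unfolding y_def a_def by (rule weight_mix)
    then have "?A *\<^sub>R (x - y) = a *\<^sub>R (y - z)"
      unfolding A' by (simp add: algebra_simps)
    then have "?A * inner ?G (x - y) = a * inner ?G (y - z)"
      by (metis inner_scaleR_right)
    moreover have "F y + inner ?G (x - y) \<le> F x"
      using Fsum_lower_bound[OF y x] grad_gap_nonneg[of x y] by linarith
    then have "?A * (F y + inner ?G (x - y)) \<le> ?A * F x"
      by (intro mult_left_mono weight_nonneg)
    ultimately show ?thesis by (simp add: distrib_left)
  qed
  have reg: "?A' * R ?x' \<le> ?A * R x + a * R z'"
    unfolding a_def by (rule convex_on_mix[OF convex_R x z'])
  have D: "dual_objective R \<eta> c u k gbar z + (norm w)\<^sup>2 / (2 * \<eta>) + a * (inner g (z' - u) + R z')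
      \<le> dual_objective R \<eta> c u (Suc k) (mix k gbar g) z'"
    unfolding dual_objective_mix a_def w_def using dual[OF z'] by simp
  have young: "- a * inner ?\<delta> w \<le> a\<^sup>2 / (2 * \<beta>) * (norm ?\<delta>)\<^sup>2 + \<beta> / 2 * (norm w)\<^sup>2"
  proof -
    have "- inner ?\<delta> w \<le> norm ?\<delta> * norm w"
      using Cauchy_Schwarz_ineq2[of ?\<delta> w] by linarith
    then have "- a * inner ?\<delta> w \<le> a * (norm ?\<delta> * norm w)"
      using a0 by (metis minus_mult_commute mult_le_cancel_left_pos)
    moreover have "0 \<le> (a * norm ?\<delta> - \<beta> * norm w)\<^sup>2 / (2 * \<beta>)" using \<beta>(1) by simp
    moreover have "(a * norm ?\<delta> - \<beta> * norm w)\<^sup>2 / (2 * \<beta>)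
        = a\<^sup>2 / (2 * \<beta>) * (norm ?\<delta>)\<^sup>2 + \<beta> / 2 * (norm w)\<^sup>2 - a * (norm ?\<delta> * norm w)"
      using \<beta>(1) by (simp add: power2_eq_square field_simps)
    ultimately show ?thesis by linarith
  qed
  have step: "Lb / 2 * (norm w)\<^sup>2 - (norm w)\<^sup>2 / (2 * \<eta>) = - (\<beta> / 2 * (norm w)\<^sup>2)"
    unfolding \<beta>(2) by (simp add: field_simps)
  have inners: "inner ?G w - inner ?G (y - z) - inner g (z' - u)
      = inner ?G (u - y) - inner ?\<delta> (z - u) - inner ?\<delta> w"
    unfolding w_def by (simp add: inner_diff_left inner_diff_right)
  have "stage_potential \<eta> c u (Suc k) (?x', z', mix k gbar g)
      = ?A' * F ?x' + ?A' * R ?x' - dual_objective R \<eta> c u (Suc k) (mix k gbar g) z'"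
    by (simp add: stage_potential_def Pobj_def distrib_left)
  also have "\<dots> \<le> (?A * F x + ?A * R x - dual_objective R \<eta> c u k gbar z) + a * F y
      + a * (inner ?G w - inner ?G (y - z) - inner g (z' - u))
      + (Lb / 2 * (norm w)\<^sup>2 - (norm w)\<^sup>2 / (2 * \<eta>))"
    using up low reg D unfolding A' by (simp add: algebra_simps)
  also have "\<dots> = stage_potential \<eta> c u k (x, z, gbar) + a * (F y + inner ?G (u - y))
      - a * inner ?\<delta> (z - u) + (- a * inner ?\<delta> w) - \<beta> / 2 * (norm w)\<^sup>2"
    unfolding inners step by (simp add: stage_potential_def Pobj_def algebra_simps)
  also have "\<dots> \<le> stage_potential \<eta> c u k (x, z, gbar) + a * (F y + inner ?G (u - y))
      - a * inner ?\<delta> (z - u) + a\<^sup>2 / (2 * \<beta>) * (norm ?\<delta>)\<^sup>2"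
    using young by linarith
  finally show ?thesis .
qed

text \<open>
  The slack of the linearization towards the snapshot \<open>xt\<close> would suffice to absorb the variance,
  but its weight \<open>1 - \<tau>\<close> may vanish. The slack towards the minimizer, with weight \<open>\<tau>\<close>, replaces it
  by \<open>grad_gap_triangle\<close>; the gap between snapshot and minimizer that this leaves behind is at
  most twice the suboptimality of the snapshot.
\<close>

lemma linearization_bound:
  assumes y: "y \<in> Rd d" and xt: "xt \<in> Rd d" and \<gamma>: "1 \<le> \<gamma>" and \<tau>: "0 \<le> \<tau>" "\<tau> \<le> 1"
  defines "u \<equiv> (1 - \<tau>) *\<^sub>R xt + \<tau> *\<^sub>R xs"
  shows "F y + inner (gF y) (u - y) + grad_gap y xt / (4 * \<gamma>)
    \<le> (1 - \<tau>) * F xt + \<tau> * F xs + \<tau> / \<gamma> * (P xt - P xs)"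
proof -
  let ?g = "grad_gap y xt" and ?q = "grad_gap xs y" and ?r = "grad_gap xt xs"
  have sym: "grad_gap xt y = ?g" by (simp add: grad_gap_def norm_minus_commute)
  have "u - y = (1 - \<tau>) *\<^sub>R (xt - y) + \<tau> *\<^sub>R (xs - y)"
    by (simp add: u_def algebra_simps)
  then have "inner (gF y) (u - y) = (1 - \<tau>) * inner (gF y) (xt - y) + \<tau> * inner (gF y) (xs - y)"
    by (simp only: inner_add_right inner_scaleR_right)
  then have split: "F y + inner (gF y) (u - y)
      = (1 - \<tau>) * (F y + inner (gF y) (xt - y)) + \<tau> * (F y + inner (gF y) (xs - y))"
    by (simp only: distrib_left) (simp add: left_diff_distrib)
  have 1: "(1 - \<tau>) * (F y + inner (gF y) (xt - y)) \<le> (1 - \<tau>) * (F xt - ?g / 2)"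
    using Fsum_lower_bound[OF y xt] \<tau> unfolding sym by (intro mult_left_mono) auto
  have 2: "\<tau> * (F y + inner (gF y) (xs - y)) \<le> \<tau> * (F xs - ?q / 2)"
    using Fsum_lower_bound[OF y xs_in_Rd] \<tau> by (intro mult_left_mono) auto
  have 3: "\<tau> * (?g / (\<gamma> + 1) - 2 * (P xt - P xs) / \<gamma>) \<le> \<tau> * ?q"
  proof (rule mult_left_mono)
    have "?r / \<gamma> \<le> 2 * (P xt - P xs) / \<gamma>"
      using grad_gap_minimizer[OF xt] \<gamma> by (intro divide_right_mono) auto
    then show "?g / (\<gamma> + 1) - 2 * (P xt - P xs) / \<gamma> \<le> ?q"
      using grad_gap_triangle[of \<gamma> y xt xs] \<gamma> by linarith
  qed (rule \<tau>)
  have 4: "?g / (4 * \<gamma>) \<le> ?g / (\<gamma> + 1) / 2"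
    using mult_right_mono[OF \<gamma> grad_gap_nonneg[of y xt]] \<gamma> by (simp add: field_simps)
  have 5: "(1 - \<tau>) * (?g / (\<gamma> + 1)) \<le> (1 - \<tau>) * ?g"
    using grad_gap_nonneg[of y xt] \<gamma> \<tau> by (intro mult_left_mono) (simp_all add: field_simps)
  have "\<tau> * (2 * p / \<gamma>) / 2 = \<tau> / \<gamma> * p" for p by simp
  then have 6: "\<tau> * (2 * (P xt - P xs) / \<gamma>) / 2 = \<tau> / \<gamma> * (P xt - P xs)" .
  have e1: "(1 - \<tau>) * (F xt - ?g / 2) = (1 - \<tau>) * F xt - (1 - \<tau>) * ?g / 2"
    and e2: "\<tau> * (F xs - ?q / 2) = \<tau> * F xs - \<tau> * ?q / 2"
    and e3: "\<tau> * (?g / (\<gamma> + 1) - 2 * (P xt - P xs) / \<gamma>)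
        = \<tau> * (?g / (\<gamma> + 1)) - \<tau> * (2 * (P xt - P xs) / \<gamma>)"
    and e4: "(1 - \<tau>) * (?g / (\<gamma> + 1)) = ?g / (\<gamma> + 1) - \<tau> * (?g / (\<gamma> + 1))"
    by (simp_all only: right_diff_distrib left_diff_distrib times_divide_eq_right mult_1
        diff_divide_distrib)
  have combine: "p1 + p2 + p3 \<le> q1 + q2 + q3"
    if "p1 \<le> q1 - r1 / 2" "p2 \<le> q2 - r2 / 2" "s - e \<le> r2" "p3 \<le> h / 2" "h - s \<le> r1" "e / 2 = q3"
    for p1 p2 p3 q1 q2 q3 r1 r2 s e h :: real
    using that by linarith
  show ?thesis
    unfolding split
    by (rule combine[OF 1[unfolded e1] 2[unfolded e2] 3[unfolded e3] 4 5[unfolded e4] 6])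
qed

context
  fixes c xt :: vec and \<gamma> \<tau> :: real and m b :: nat
  assumes c: "c \<in> Rd d" and xt: "xt \<in> Rd d" and \<gamma>: "1 \<le> \<gamma>" and \<tau>: "0 \<le> \<tau>" "\<tau> \<le> 1"
    and b: "1 \<le> b"
begin

private abbreviation (input) "\<eta> \<equiv> step_size n L \<gamma> m b"
private abbreviation (input) "u \<equiv> (1 - \<tau>) *\<^sub>R xt + \<tau> *\<^sub>R xs"
private abbreviation (input) "B \<equiv> (1 - \<tau>) * F xt + \<tau> * F xs + \<tau> / \<gamma> * (P xt - P xs)"

lemma step_size_pos: "\<eta> > 0"
  using Lb_pos \<gamma> by (simp add: step_size_def add_pos_nonneg)

lemma inverse_step_size: "1 / \<eta> - Lb = \<gamma> * (real m + 1) / real b * Lb"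
  by (simp add: step_size_def algebra_simps)

text \<open>
  The step size is chosen so that \<open>\<beta>\<close> is \<open>\<gamma> (m + 1) / b\<close> times \<open>Lbar\<close>. This cancels \<open>Lbar / b\<close> in
  the variance, and since the iteration weight \<open>a\<close> is at most \<open>(m + 1) / 2\<close>, the noise is at most
  \<open>a / (4 \<gamma>)\<close> times the gap.
\<close>

lemma stage_potential_expected_step:
  assumes inv: "stage_invariant \<eta> c u k (x, z, gbar)" and k: "k < m"
  shows "measure_pmf.expectation (replicate_pmf b Q) (\<lambda>I.
      let gbar' = mix k gbar (vr_gradient d n f L b xt (mix k x z) I);
          z' = dual_step d R \<eta> c k gbar'
      in stage_potential \<eta> c u (Suc k) (mix k x z', z', gbar'))
    \<le> stage_potential \<eta> c u k (x, z, gbar) + (real k + 1) / 2 * B"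
proof -
  define y where "y = mix k x z"
  define a where "a = (real k + 1) / 2"
  define \<beta> where "\<beta> = 1 / \<eta> - Lb"
  define \<delta> where "\<delta> = (\<lambda>I. vr_gradient d n f L b xt y I - gF y)"
  have y: "y \<in> Rd d" using inv by (auto simp: y_def stage_invariant_def intro: mix_in_Rd)
  have a0: "a > 0" and am: "a \<le> (real m + 1) / 2" using k by (auto simp: a_def)
  have \<beta>: "\<beta> = \<gamma> * (real m + 1) / real b * Lb" unfolding \<beta>_def by (rule inverse_step_size)
  have \<beta>0: "\<beta> > 0" unfolding \<beta> using \<gamma> b Lb_pos by simp
  have fin: "finite (set_pmf (replicate_pmf b Q))"
    by (rule finite_set_replicate_pmf[OF finite_set_pmf_Qdist])
  note [simp] = integrable_measure_pmf_finite[OF fin]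
  let ?E = "measure_pmf.expectation (replicate_pmf b Q)"
  let ?p = "stage_potential \<eta> c u k (x, z, gbar) + a * (F y + inner (gF y) (u - y))"
  have "?E (\<lambda>I. let gbar' = mix k gbar (vr_gradient d n f L b xt (mix k x z) I);
          z' = dual_step d R \<eta> c k gbar'
      in stage_potential \<eta> c u (Suc k) (mix k x z', z', gbar'))
    \<le> ?E (\<lambda>I. ?p - a * inner (\<delta> I) (z - u) + a\<^sup>2 / (2 * \<beta>) * (norm (\<delta> I))\<^sup>2)"
    unfolding Let_def \<delta>_def a_def y_def
    by (intro expectation_mono_finite[OF fin] stage_potential_step inv c step_size_pos \<beta>0 \<beta>_def)
  also have "\<dots> = ?p - a * ?E (\<lambda>I. inner (\<delta> I) (z - u)) + a\<^sup>2 / (2 * \<beta>) * ?E (\<lambda>I. (norm (\<delta> I))\<^sup>2)"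
    by (simp del: times_divide_eq_left)
  also have "\<dots> \<le> ?p + a\<^sup>2 / (2 * \<beta>) * (Lb / real b * grad_gap y xt)"
    unfolding \<delta>_def vr_gradient_unbiased[OF xt y b] using \<beta>0
    by (auto intro!: mult_left_mono vr_gradient_variance[OF xt y b]
        simp del: times_divide_eq_left times_divide_eq_right)
  also have "\<dots> \<le> ?p + a * (grad_gap y xt / (4 * \<gamma>))"
  proof -
    have "M * 2 \<noteq> 0 \<Longrightarrow> a\<^sup>2 / (2 * (\<gamma> * M / real b * Lb)) * (Lb / real b * grad_gap y xt)
        = a * (grad_gap y xt * (a / (2 * \<gamma> * M)))" for M
      using b Lb_pos \<gamma> by (simp add: power2_eq_square field_simps)
    then have "a\<^sup>2 / (2 * \<beta>) * (Lb / real b * grad_gap y xt)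
        = a * (grad_gap y xt * (a / (2 * \<gamma> * (real m + 1))))"
      unfolding \<beta> by simp
    also have "\<dots> \<le> a * (grad_gap y xt * (1 / (4 * \<gamma>)))"
    proof (intro mult_left_mono grad_gap_nonneg)
      have "a / (2 * \<gamma> * M) \<le> 1 / (4 * \<gamma>)" if "2 * a \<le> M" "M > 0" for M
        using that \<gamma> by (simp add: field_simps)
      then show "a / (2 * \<gamma> * (real m + 1)) \<le> 1 / (4 * \<gamma>)" using am by simp
    qed (use a0 in simp)
    finally show ?thesis by simp
  qed
  also have "\<dots> = stage_potential \<eta> c u k (x, z, gbar) + a *
      (F y + inner (gF y) (u - y) + grad_gap y xt / (4 * \<gamma>))"
    by (simp add: distrib_left)
  also have "\<dots> \<le> stage_potential \<eta> c u k (x, z, gbar) + a * B"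
    using a0 linearization_bound[OF y xt \<gamma> \<tau>] by (intro add_left_mono mult_left_mono) auto
  finally show ?thesis unfolding a_def .
qed

lemma stage_potential_expected:
  assumes "k \<le> m"
  shows "measure_pmf.expectation (acc_svrda_iter cost d n f L R c xt \<eta> b k)
      (\<lambda>(x, z, gbar, e). stage_potential \<eta> c u k (x, z, gbar)) \<le> weight k * B"
  using assms
proof (induction k)
  case 0
  then show ?case by (simp add: stage_potential_def dual_objective_def weight_def)
next
  case (Suc k)
  let ?M = "acc_svrda_iter cost d n f L R c xt \<eta> b k"
  note fin = finite_set_acc_svrda_iter
  have fin': "finite (set_pmf (replicate_pmf b Q))"
    by (rule finite_set_replicate_pmf[OF finite_set_pmf_Qdist])
  have "measure_pmf.expectation (acc_svrda_iter cost d n f L R c xt \<eta> b (Suc k))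
      (\<lambda>(x, z, gbar, e). stage_potential \<eta> c u (Suc k) (x, z, gbar))
    = measure_pmf.expectation ?M (\<lambda>(x, z, gbar, e).
       measure_pmf.expectation (replicate_pmf b Q) (\<lambda>I.
      let gbar' = mix k gbar (vr_gradient d n f L b xt (mix k x z) I);
          z' = dual_step d R \<eta> c k gbar'
      in stage_potential \<eta> c u (Suc k) (mix k x z', z', gbar')))"
    unfolding acc_svrda_iter_Suc_mix case_prod_unfold
    by (simp add: expectation_bind_finite fin fin' Let_def)
  also have "\<dots> \<le> measure_pmf.expectation ?M (\<lambda>s.
      (case s of (x, z, gbar, e) \<Rightarrow> stage_potential \<eta> c u k (x, z, gbar)) + (real k + 1) / 2 * B)"
    using stage_potential_expected_step Suc.prems acc_svrda_iter_invariant[OF c step_size_pos]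
    by (intro expectation_mono_finite[OF fin]) (force split: prod.splits)
  also have "\<dots> = measure_pmf.expectation ?M (\<lambda>(x, z, gbar, e). stage_potential \<eta> c u k (x, z, gbar))
      + (real k + 1) / 2 * B"
    by (subst Bochner_Integration.integral_add)
        (simp_all add: integrable_measure_pmf_finite[OF fin])
  also have "\<dots> \<le> weight k * B + (real k + 1) / 2 * B"
    using Suc by simp
  finally show ?case by (simp only: weight_Suc distrib_right)
qed

text \<open>
  Quadratic growth of the dual objective at the final \<open>z\<close>, tested at \<open>u\<close>, converts the bound on
  the potential into one on the objective value and yields the distance of \<open>z\<close> to \<open>u\<close>.
\<close>

lemma one_stage_progress:
  "measure_pmf.expectation (one_stage_acc_svrda cost d n f L R c xt \<eta> m b)
      (\<lambda>(x, z, e). weight m * (P x - P xs) + (norm (z - u))\<^sup>2 / (2 * \<eta>))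
    \<le> weight m * ((1 - \<tau> + \<tau> / \<gamma>) * (P xt - P xs)) + (norm (c - u))\<^sup>2 / (2 * \<eta>)"
proof -
  let ?M = "acc_svrda_iter cost d n f L R c xt \<eta> b m"
  let ?C = "weight m * R u + (norm (c - u))\<^sup>2 / (2 * \<eta>) - weight m * P xs"
  note fin = finite_set_acc_svrda_iter
  have u: "u \<in> Rd d"
    by (intro subspace_add[OF subspace_Rd] subspace_scale[OF subspace_Rd] xt xs_in_Rd)
  have Ru: "R u \<le> (1 - \<tau>) * R xt + \<tau> * R xs"
    using \<tau> by (intro convex_onD[OF convex_R] xt xs_in_Rd)
  have pointwise: "weight m * (P x - P xs) + (norm (z - u))\<^sup>2 / (2 * \<eta>)
      \<le> stage_potential \<eta> c u m (x, z, gbar) + ?C"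
    if s: "(x, z, gbar, e) \<in> set_pmf ?M" for x z gbar e
  proof -
    have "dual_objective R \<eta> c u m gbar z + (norm (u - z))\<^sup>2 / (2 * \<eta>)
        \<le> dual_objective R \<eta> c u m gbar u"
      using acc_svrda_iter_invariant[OF c step_size_pos s] u by (auto simp: stage_invariant_def)
    also have "\<dots> = weight m * R u + (norm (c - u))\<^sup>2 / (2 * \<eta>)"
      by (simp add: dual_objective_def norm_minus_commute)
    finally show ?thesis
      by (simp add: stage_potential_def norm_minus_commute[of z] right_diff_distrib)
  qed
  have "measure_pmf.expectation (one_stage_acc_svrda cost d n f L R c xt \<eta> m b)
      (\<lambda>(x, z, e). weight m * (P x - P xs) + (norm (z - u))\<^sup>2 / (2 * \<eta>))
    = measure_pmf.expectation ?M
        (\<lambda>(x, z, gbar, e). weight m * (P x - P xs) + (norm (z - u))\<^sup>2 / (2 * \<eta>))"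
    by (simp add: one_stage_acc_svrda_def case_prod_unfold)
  also have "\<dots> \<le> measure_pmf.expectation ?M (\<lambda>s.
      (case s of (x, z, gbar, e) \<Rightarrow> stage_potential \<eta> c u m (x, z, gbar)) + ?C)"
    by (rule expectation_mono_finite[OF fin]) (use pointwise in \<open>auto split: prod.splits\<close>)
  also have "\<dots> = measure_pmf.expectation ?M
      (\<lambda>(x, z, gbar, e). stage_potential \<eta> c u m (x, z, gbar)) + ?C"
    by (subst Bochner_Integration.integral_add)
        (simp_all add: integrable_measure_pmf_finite[OF fin])
  also have "\<dots> \<le> weight m * B + ?C"
    using stage_potential_expected[of m] by simp
  also have "\<dots> \<le> weight m * B + (weight m * ((1 - \<tau>) * R xt + \<tau> * R xs)
      + (norm (c - u))\<^sup>2 / (2 * \<eta>) - weight m * P xs)"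
    using mult_left_mono[OF Ru weight_nonneg, of m] by simp
  also have "\<dots> = weight m * (B + ((1 - \<tau>) * R xt + \<tau> * R xs) - P xs) + (norm (c - u))\<^sup>2 / (2 * \<eta>)"
    by (simp only: distrib_left right_diff_distrib)
  also have "B + ((1 - \<tau>) * R xt + \<tau> * R xs) - P xs = (1 - \<tau> + \<tau> / \<gamma>) * (P xt - P xs)"
    by (simp add: Pobj_def algebra_simps add_divide_distrib diff_divide_distrib)
  finally show ?thesis .
qed

end

end

section \<open>Outer acceleration and restarts\<close>

text \<open>
  The outer parameters grow slightly more slowly than in the deterministic scheme, which makes
  room for the loss \<open>1 / \<gamma>\<close> per stage.
\<close>

lemma theta_outer_recursion:
  assumes "1 \<le> \<gamma>"
  shows "theta_outer \<gamma> (Suc s) * (theta_outer \<gamma> (Suc s) - 1 + 1 / \<gamma>) \<le> (theta_outer \<gamma> s)\<^sup>2"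
proof -
  let ?c = "1 - 1 / \<gamma>"
  have "theta_outer \<gamma> (Suc s) * (theta_outer \<gamma> (Suc s) - 1 + 1 / \<gamma>)
      = (theta_outer \<gamma> s)\<^sup>2 - ?c\<^sup>2 / 4"
    by (simp add: theta_outer_def power2_eq_square algebra_simps add_divide_distrib
        diff_divide_distrib)
  then show ?thesis by simp
qed

text \<open>
  The inverse of the outer parameter serves as the weight of a convex combination. In the first
  stage this is the condition \<open>\<gamma> \<ge> 3\<close>.
\<close>

lemma theta_outer_ge_1:
  assumes "3 \<le> \<gamma>"
  shows "1 \<le> theta_outer \<gamma> (Suc s)"
proof -
  have "2 / 3 \<le> 1 - 1 / \<gamma>" using assms by (simp add: field_simps)
  then have "2 / 3 * (real s + 3) \<le> (1 - 1 / \<gamma>) * (real s + 3)" by (intro mult_right_mono) auto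
  moreover have "2 \<le> 2 / 3 * (real s + 3)" by simp
  ultimately have "2 \<le> (1 - 1 / \<gamma>) * (real s + 3)" by (rule order_trans[rotated])
  then show ?thesis by (simp add: theta_outer_def add.commute)
qed

context composite_problem
begin

lemma finite_set_one_stage: "finite (set_pmf (one_stage_acc_svrda cost d n f L R c xt \<eta> m b))"
  by (simp add: one_stage_acc_svrda_def finite_set_acc_svrda_iter)

lemma one_stage_in_Rd:
  assumes "c \<in> Rd d" "\<eta> > 0" "(x, z, e) \<in> set_pmf (one_stage_acc_svrda cost d n f L R c xt \<eta> m b)"
  shows "x \<in> Rd d \<and> z \<in> Rd d"
  using assms(3) acc_svrda_iter_invariant[OF assms(1,2)]
  by (fastforce simp: one_stage_acc_svrda_def stage_invariant_def)

lemma finite_set_dasvrda_ns_iter: "finite (set_pmf (dasvrda_ns_iter cost d n f L R x0 z0 \<gamma> m b s))"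
  by (induction s) (auto simp: Let_def finite_set_one_stage)

lemma finite_set_dasvrda_sc: "finite (set_pmf (dasvrda_sc cost d n f L R x0 \<gamma> m b S t))"
  by (induction t) (auto simp: dasvrda_ns_def finite_set_dasvrda_ns_iter)

text \<open>
  The vector in the norm is the outer parameter times the difference between the comparator and
  the stage output \<open>z\<close>. By the extrapolation rule it is also the scaled difference between the
  comparator of the following stage and its starting point.
\<close>

definition outer_potential :: "real \<Rightarrow> real \<Rightarrow> nat \<Rightarrow> nat \<Rightarrow> vec \<times> vec \<times> vec \<Rightarrow> real" where
  "outer_potential \<gamma> \<eta> m s = (\<lambda>(x, xprev, z). (theta_outer \<gamma> s)\<^sup>2 * (P x - P xs)
     + (norm (xs + (theta_outer \<gamma> s - 1) *\<^sub>R xprev - theta_outer \<gamma> s *\<^sub>R z))\<^sup>2 /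
         (2 * \<eta> * weight m))"

definition extrapolation :: "real \<Rightarrow> nat \<Rightarrow> vec \<Rightarrow> vec \<Rightarrow> vec \<Rightarrow> vec" where
  "extrapolation \<gamma> s x xprev z =
     x + ((theta_outer \<gamma> s - 1) / theta_outer \<gamma> (Suc s)) *\<^sub>R (x - xprev)
       + (theta_outer \<gamma> s / theta_outer \<gamma> (Suc s)) *\<^sub>R (z - x)"

lemma dasvrda_ns_iter_Suc_extrapolation:
  "dasvrda_ns_iter cost d n f L R x0 z0 \<gamma> m b (Suc s) =
     dasvrda_ns_iter cost d n f L R x0 z0 \<gamma> m b s \<bind> (\<lambda>(x, xprev, z, e).
       one_stage_acc_svrda cost d n f L R (extrapolation \<gamma> s x xprev z) x (step_size n L \<gamma> m b) m b
         \<bind> (\<lambda>(x', z', e'). return_pmf (x', x, z', e + 6 * cost Vec_Op + e')))"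
  by (simp add: Let_def extrapolation_def)

lemma extrapolation_in_Rd:
  assumes "x \<in> Rd d" "xprev \<in> Rd d" "z \<in> Rd d"
  shows "extrapolation \<gamma> s x xprev z \<in> Rd d"
  unfolding extrapolation_def using assms
  by (intro subspace_add[OF subspace_Rd] subspace_scale[OF subspace_Rd]
      subspace_diff[OF subspace_Rd])

context
  fixes \<gamma> :: real and m b :: nat
  assumes \<gamma>: "3 \<le> \<gamma>" and m: "1 \<le> m" and b: "1 \<le> b"
begin

private abbreviation (input) "step \<equiv> step_size n L \<gamma> m b"

lemma eta_pos: "step > 0"
  using step_size_pos[OF xs_in_Rd xs_in_Rd, of \<gamma> 0 b m] \<gamma> b by simp

lemma weight_m_pos: "weight m > 0"
  using m by (simp add: weight_def)

lemma dasvrda_ns_iter_in_Rd: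
  assumes "x0 \<in> Rd d" "z0 \<in> Rd d"
    and "(x, xprev, z, e) \<in> set_pmf (dasvrda_ns_iter cost d n f L R x0 z0 \<gamma> m b s)"
  shows "x \<in> Rd d \<and> xprev \<in> Rd d \<and> z \<in> Rd d"
  using assms(3)
proof (induction s arbitrary: x xprev z e)
  case 0
  then show ?case using assms by simp
next
  case (Suc s)
  then obtain xpp zp e1 e2 where
    prev: "(xprev, xpp, zp, e1) \<in> set_pmf (dasvrda_ns_iter cost d n f L R x0 z0 \<gamma> m b s)"
    and stage: "(x, z, e2) \<in> set_pmf (one_stage_acc_svrda cost d n f L R
        (extrapolation \<gamma> s xprev xpp zp) xprev step m b)"
    by (auto simp: dasvrda_ns_iter_Suc_extrapolation simp del: dasvrda_ns_iter.simps(2))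
  have "xprev \<in> Rd d" "xpp \<in> Rd d" "zp \<in> Rd d" using Suc.IH[OF prev] by auto
  with one_stage_in_Rd[OF extrapolation_in_Rd eta_pos stage] show ?case by blast
qed

lemma outer_potential_expected_step:
  assumes x: "x \<in> Rd d" and xprev: "xprev \<in> Rd d" and z: "z \<in> Rd d"
  shows "measure_pmf.expectation
      (one_stage_acc_svrda cost d n f L R (extrapolation \<gamma> s x xprev z) x step m b)
      (\<lambda>(x', z', e). outer_potential \<gamma> step m (Suc s) (x', x, z'))
    \<le> outer_potential \<gamma> step m s (x, xprev, z)"
proof -
  define y where "y = extrapolation \<gamma> s x xprev z"
  define t where "t = theta_outer \<gamma> (Suc s)"
  define t' where "t' = theta_outer \<gamma> s"
  define u where "u = (1 - 1 / t) *\<^sub>R x + (1 / t) *\<^sub>R xs"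
  let ?w = "weight m"
  note w = weight_m_pos
  have t: "1 \<le> t" unfolding t_def by (rule theta_outer_ge_1[OF \<gamma>])
  have tu: "t *\<^sub>R u = (t - 1) *\<^sub>R x + xs"
    using t by (simp add: u_def scaleR_add_right right_diff_distrib)
  have ty: "t *\<^sub>R y = t *\<^sub>R x + (t' - 1) *\<^sub>R (x - xprev) + t' *\<^sub>R (z - x)"
    using t by (simp add: y_def extrapolation_def scaleR_add_right t_def t'_def)
  have scaled: "t\<^sup>2 * (norm (p - u))\<^sup>2 = (norm (t *\<^sub>R p - t *\<^sub>R u))\<^sup>2" for p
    using t by (simp add: power_mult_distrib flip: scaleR_diff_right)
  have dist_z: "t\<^sup>2 * (norm (p - u))\<^sup>2 = (norm (xs + (t - 1) *\<^sub>R x - t *\<^sub>R p))\<^sup>2" for p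
    unfolding scaled tu by (subst norm_minus_commute) (simp add: add.commute)
  have dist_y: "t\<^sup>2 * (norm (y - u))\<^sup>2 = (norm (xs + (t' - 1) *\<^sub>R xprev - t' *\<^sub>R z))\<^sup>2"
    unfolding scaled tu ty by (subst norm_minus_commute) (simp add: algebra_simps)
  let ?M = "one_stage_acc_svrda cost d n f L R y x step m b"
  have coeff: "t\<^sup>2 * (1 - 1 / t + 1 / t / \<gamma>) \<le> t'\<^sup>2"
  proof -
    have "t\<^sup>2 * (1 - 1 / t + 1 / t / \<gamma>) = t * (t - 1 + 1 / \<gamma>)"
      using t by (simp add: power2_eq_square field_simps)
    then show ?thesis using theta_outer_recursion[of \<gamma> s] \<gamma> by (simp add: t_def t'_def)
  qed
  have split: "t\<^sup>2 * p + t\<^sup>2 * q / (2 * step * ?w)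
      = t\<^sup>2 / ?w * (?w * p + q / (2 * step))" for p q :: real
    using w eta_pos by (simp add: field_simps)
  have "measure_pmf.expectation ?M (\<lambda>(x', z', e). outer_potential \<gamma> step m (Suc s) (x', x, z'))
      = t\<^sup>2 / ?w * measure_pmf.expectation ?M
          (\<lambda>(x', z', e). ?w * (P x' - P xs) + (norm (z' - u))\<^sup>2 / (2 * step))"
    unfolding outer_potential_def prod.case t_def[symmetric] dist_z[symmetric] split
    by (simp add: case_prod_unfold)
  also have "\<dots> \<le> t\<^sup>2 / ?w * (?w * ((1 - 1 / t + 1 / t / \<gamma>) * (P x - P xs)) + (norm (y - u))\<^sup>2 /
      (2 * step))"
    unfolding u_def using t \<gamma> b w x
    by (intro mult_left_mono one_stage_progress)
      (auto simp: y_def intro: extrapolation_in_Rd x xprev z)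
  also have "\<dots> = t\<^sup>2 * (1 - 1 / t + 1 / t / \<gamma>) * (P x - P xs) + t\<^sup>2 * (norm (y - u))\<^sup>2 /
      (2 * step * ?w)"
    unfolding split[symmetric] by simp
  also have "\<dots> \<le> t'\<^sup>2 * (P x - P xs) + (norm (xs + (t' - 1) *\<^sub>R xprev - t' *\<^sub>R z))\<^sup>2 /
      (2 * step * ?w)"
    unfolding dist_y using P_min[OF x] by (intro add_right_mono mult_right_mono coeff) simp
  also have "\<dots> = outer_potential \<gamma> step m s (x, xprev, z)"
    by (simp add: outer_potential_def t'_def)
  finally show ?thesis unfolding y_def .
qed

lemma outer_potential_expected:
  assumes x0: "x0 \<in> Rd d" and z0: "z0 \<in> Rd d"
  shows "measure_pmf.expectation (dasvrda_ns_iter cost d n f L R x0 z0 \<gamma> m b s)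
      (\<lambda>(x, xprev, z, e). outer_potential \<gamma> step m s (x, xprev, z))
    \<le> outer_potential \<gamma> step m 0 (x0, z0, z0)"
proof (induction s)
  case (Suc s)
  let ?M = "dasvrda_ns_iter cost d n f L R x0 z0 \<gamma> m b s"
  note fin = finite_set_dasvrda_ns_iter
  have "measure_pmf.expectation (dasvrda_ns_iter cost d n f L R x0 z0 \<gamma> m b (Suc s))
      (\<lambda>(x, xprev, z, e). outer_potential \<gamma> step m (Suc s) (x, xprev, z))
    = measure_pmf.expectation ?M (\<lambda>(x, xprev, z, e). measure_pmf.expectation
      (one_stage_acc_svrda cost d n f L R (extrapolation \<gamma> s x xprev z) x step m b)
      (\<lambda>(x', z', e). outer_potential \<gamma> step m (Suc s) (x', x, z')))"
    unfolding dasvrda_ns_iter_Suc_extrapolation case_prod_unfold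
    by (simp add: expectation_bind_finite fin finite_set_one_stage)
  also have "\<dots> \<le> measure_pmf.expectation ?M
      (\<lambda>(x, xprev, z, e). outer_potential \<gamma> step m s (x, xprev, z))"
    using dasvrda_ns_iter_in_Rd[OF x0 z0]
    by (intro expectation_mono_finite[OF fin])
        (force split: prod.splits intro: outer_potential_expected_step)
  also note Suc
  finally show ?case .
qed simp

text \<open>
  At \<open>s = 0\<close> both the previous point and \<open>z\<close> equal \<open>z0\<close>, so the coefficients of the initial vector
  add up to a plain distance.
\<close>

theorem dasvrda_ns_convergence:
  assumes x0: "x0 \<in> Rd d" and z0: "z0 \<in> Rd d"
  shows "(theta_outer \<gamma> S)\<^sup>2 * measure_pmf.expectation (dasvrda_ns cost d n f L R x0 z0 \<gamma> m b S)
      (\<lambda>(x, e). P x - P xs)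
    \<le> (1 - 1 / \<gamma>)\<^sup>2 * (P x0 - P xs) + 2 / (step * (real m + 1) * real m) * (norm (z0 - xs))\<^sup>2"
proof -
  let ?M = "dasvrda_ns_iter cost d n f L R x0 z0 \<gamma> m b S"
  note fin = finite_set_dasvrda_ns_iter
  have "(theta_outer \<gamma> S)\<^sup>2 * measure_pmf.expectation (dasvrda_ns cost d n f L R x0 z0 \<gamma> m b S)
      (\<lambda>(x, e). P x - P xs)
      = measure_pmf.expectation ?M (\<lambda>(x, xprev, z, e). (theta_outer \<gamma> S)\<^sup>2 * (P x - P xs))"
    by (simp add: dasvrda_ns_def case_prod_unfold)
  also have "\<dots> \<le> measure_pmf.expectation ?M
      (\<lambda>(x, xprev, z, e). outer_potential \<gamma> step m S (x, xprev, z))"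
    using eta_pos weight_m_pos
    by (intro expectation_mono_finite[OF fin]) (auto simp: outer_potential_def split: prod.splits)
  also have "\<dots> \<le> outer_potential \<gamma> step m 0 (x0, z0, z0)"
    by (rule outer_potential_expected[OF x0 z0])
  also have "\<dots> = (1 - 1 / \<gamma>)\<^sup>2 * (P x0 - P xs) + 2 / (step * (real m + 1) * real m) *
      (norm (z0 - xs))\<^sup>2"
  proof -
    have v: "xs + (q - 1) *\<^sub>R z0 - q *\<^sub>R z0 = xs - z0" for q
      by (simp add: algebra_simps)
    have w: "p / (2 * step * weight m) = 2 / (step * (real m + 1) * real m) * p" for p
      by (simp add: weight_def mult_ac)
    moreover have "theta_outer \<gamma> 0 = 1 - 1 / \<gamma>"
      by (simp add: theta_outer_def)
    ultimately show ?thesis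
      unfolding outer_potential_def prod.case v w by (simp only: norm_minus_commute[of xs])
  qed
  finally show ?thesis .
qed

lemma dasvrda_ns_contraction:
  assumes x0: "x0 \<in> Rd d" and \<mu>: "0 < \<mu>" "opt_strongly_convex d \<mu> P"
  shows "measure_pmf.expectation (dasvrda_ns cost d n f L R x0 x0 \<gamma> m b S) (\<lambda>(x, e). P x - P xs)
    \<le> rho \<gamma> step \<mu> m S * (P x0 - P xs)"
proof -
  let ?E = "measure_pmf.expectation (dasvrda_ns cost d n f L R x0 x0 \<gamma> m b S) (\<lambda>(x, e). P x - P xs)"
  let ?c = "1 - 1 / \<gamma>" and ?D = "P x0 - P xs" and ?k = "step * (real m + 1) * real m"
  have c: "?c > 0" using \<gamma> by simp
  have k: "?k > 0" using eta_pos m by simp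
  have "\<mu> / 2 * (norm (x0 - xs))\<^sup>2 \<le> ?D"
    using \<mu>(2) x0 minimizer_xs by (auto simp: opt_strongly_convex_def)
  then have "(norm (x0 - xs))\<^sup>2 \<le> 2 / \<mu> * ?D" using \<mu>(1) by (simp add: field_simps)
  then have "2 / ?k * (norm (x0 - xs))\<^sup>2 \<le> 2 / ?k * (2 / \<mu> * ?D)"
    using k by (intro mult_left_mono) auto
  then have "(theta_outer \<gamma> S)\<^sup>2 * ?E \<le> (?c\<^sup>2 + 4 / (?k * \<mu>)) * ?D"
    using dasvrda_ns_convergence[OF x0 x0, of S cost] by (simp add: distrib_right)
  moreover have "(theta_outer \<gamma> S)\<^sup>2 = ?c\<^sup>2 * (real S + 2)\<^sup>2 / 4"
    by (simp add: theta_outer_def power_mult_distrib power_divide)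
  moreover have "?c\<^sup>2 * (real S + 2)\<^sup>2 > 0"
    using c by (intro mult_pos_pos zero_less_power) auto
  ultimately have "?E \<le> 4 * ((?c\<^sup>2 + 4 / (?k * \<mu>)) * ?D) / (?c\<^sup>2 * (real S + 2)\<^sup>2)"
    by (simp only: pos_le_divide_eq) (simp add: mult.commute)
  then show ?thesis unfolding rho_def by (simp only: mult.assoc times_divide_eq_left)
qed

lemma dasvrda_sc_in_Rd:
  assumes x0: "x0 \<in> Rd d" and "(x, e) \<in> set_pmf (dasvrda_sc cost d n f L R x0 \<gamma> m b S t)"
  shows "x \<in> Rd d"
  using assms(2)
proof (induction t arbitrary: x e)
  case (Suc t)
  then obtain x1 e1 xp z e2 where
    prev: "(x1, e1) \<in> set_pmf (dasvrda_sc cost d n f L R x0 \<gamma> m b S t)"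
    and stage: "(x, xp, z, e2) \<in> set_pmf (dasvrda_ns_iter cost d n f L R x1 x1 \<gamma> m b S)"
    by (auto simp: dasvrda_ns_def)
  show ?case using dasvrda_ns_iter_in_Rd[OF _ _ stage] Suc.IH[OF prev] by blast
qed (simp add: x0)

lemma dasvrda_sc_convergence:
  assumes x0: "x0 \<in> Rd d" and \<mu>: "0 < \<mu>" "opt_strongly_convex d \<mu> P"
  shows "measure_pmf.expectation (dasvrda_sc cost d n f L R x0 \<gamma> m b S T) (\<lambda>(x, e). P x - P xs)
    \<le> rho \<gamma> step \<mu> m S ^ T * (P x0 - P xs)"
proof (induction T)
  case (Suc T)
  let ?M = "dasvrda_sc cost d n f L R x0 \<gamma> m b S T"
  let ?r = "rho \<gamma> step \<mu> m S"
  note fin = finite_set_dasvrda_sc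
  have fin': "finite (set_pmf (dasvrda_ns cost d n f L R x x \<gamma> m b S))" for x
    by (simp add: dasvrda_ns_def finite_set_dasvrda_ns_iter)
  have r: "0 \<le> ?r" unfolding rho_def using eta_pos m \<mu>(1) by simp
  have "measure_pmf.expectation (dasvrda_sc cost d n f L R x0 \<gamma> m b S (Suc T)) (\<lambda>(x, e). P x - P xs)
      = measure_pmf.expectation ?M (\<lambda>(x, e). measure_pmf.expectation
          (dasvrda_ns cost d n f L R x x \<gamma> m b S) (\<lambda>(x, e). P x - P xs))"
    unfolding dasvrda_sc.simps case_prod_unfold
    by (simp add: expectation_bind_finite fin fin')
  also have "\<dots> \<le> measure_pmf.expectation ?M (\<lambda>s. ?r * (case s of (x, e) \<Rightarrow> P x - P xs))"
    using dasvrda_sc_in_Rd[OF x0] dasvrda_ns_contraction[OF _ \<mu>]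
    by (intro expectation_mono_finite[OF fin]) (force split: prod.splits)
  also have "\<dots> = ?r * measure_pmf.expectation ?M (\<lambda>(x, e). P x - P xs)"
    by simp
  also have "\<dots> \<le> ?r * (?r ^ T * (P x0 - P xs))"
    by (intro mult_left_mono Suc r)
  finally show ?case by simp
qed simp

end

end

section \<open>Cost of a run\<close>

lemma acc_svrda_iter_cost:
  "(x, z, g, e) \<in> set_pmf (acc_svrda_iter cost d n f L R c xt \<eta> b k) \<Longrightarrow>
    e = full_grad_cost cost n + real k * inner_iter_cost cost b"
proof (induction k arbitrary: x z g e)
  case (Suc k)
  then obtain x1 z1 g1 e1 where
    prev: "(x1, z1, g1, e1) \<in> set_pmf (acc_svrda_iter cost d n f L R c xt \<eta> b k)"
    and e: "e = e1 + inner_iter_cost cost b"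
    by (auto simp: Let_def)
  show ?case using Suc.IH[OF prev] e by (simp add: algebra_simps)
qed simp

definition stage_cost :: "(oper \<Rightarrow> real) \<Rightarrow> nat \<Rightarrow> nat \<Rightarrow> nat \<Rightarrow> real" where
  "stage_cost cost n m b = 6 * cost Vec_Op + full_grad_cost cost n
      + real m * inner_iter_cost cost b"

lemma dasvrda_ns_iter_cost:
  "(x, x', z, e) \<in> set_pmf (dasvrda_ns_iter cost d n f L R x0 z0 \<gamma> m b s) \<Longrightarrow>
    e = real s * stage_cost cost n m b"
proof (induction s arbitrary: x x' z e)
  case (Suc s)
  then obtain xp zp e1 y g e2 where
    prev: "(x', xp, zp, e1) \<in> set_pmf (dasvrda_ns_iter cost d n f L R x0 z0 \<gamma> m b s)"
    and stage: "(x, z, g, e2) \<in> set_pmf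
        (acc_svrda_iter cost d n f L R y x' (step_size n L \<gamma> m b) b m)"
    and e: "e = e1 + 6 * cost Vec_Op + e2"
    by (auto simp: Let_def one_stage_acc_svrda_def)
  show ?case
    using Suc.IH[OF prev] acc_svrda_iter_cost[OF stage] e
    by (simp add: stage_cost_def algebra_simps)
qed simp

lemma dasvrda_sc_cost:
  "(x, e) \<in> set_pmf (dasvrda_sc cost d n f L R x0 \<gamma> m b S T) \<Longrightarrow>
    e = real T * (real S * stage_cost cost n m b)"
proof (induction T arbitrary: x e)
  case (Suc T)
  then obtain x1 e1 xp z e2 where
    prev: "(x1, e1) \<in> set_pmf (dasvrda_sc cost d n f L R x0 \<gamma> m b S T)"
    and stage: "(x, xp, z, e2) \<in> set_pmf (dasvrda_ns_iter cost d n f L R x1 x1 \<gamma> m b S)"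
    and e: "e = e1 + e2"
    by (auto simp: dasvrda_ns_def)
  show ?case
    using Suc.IH[OF prev] dasvrda_ns_iter_cost[OF stage] e by (simp add: algebra_simps)
qed simp

section \<open>Choice of the numbers of stages and restarts\<close>

lemma gamma_star_ge_3: "3 \<le> gamma_star m b"
proof -
  have "sqrt (3\<^sup>2) \<le> sqrt (9 + 8 * real b / (real m + 1))" by (subst real_sqrt_le_iff) simp
  then show ?thesis by (simp add: gamma_star_def)
qed

lemma gamma_star_le: "gamma_star m b \<le> 3 + sqrt (2 * real b / (real m + 1))"
proof -
  have "sqrt (9 + 8 * real b / (real m + 1))
      \<le> sqrt (3\<^sup>2) + sqrt (2\<^sup>2 * (2 * real b / (real m + 1)))"
    using sqrt_add_le_add_sqrt[of "3\<^sup>2" "2\<^sup>2 * (2 * real b / (real m + 1))"] by simp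
  also have "\<dots> = 3 + 2 * sqrt (2 * real b / (real m + 1))"
    unfolding real_sqrt_mult[of "2\<^sup>2"] by simp
  finally show ?thesis by (simp add: gamma_star_def)
qed

text \<open>
  The sum of the coefficients of \<open>p\<^sup>2\<close>, \<open>q\<^sup>2\<close> and \<open>p q\<close> in the next bound, for \<open>p = b / n\<close> and
  \<open>q = 1 / sqrt n\<close>.
\<close>

definition condition_constant :: "real \<Rightarrow> real" where
  "condition_constant c = 1 / c\<^sup>2 + 3 / c + sqrt (2 / c) / c"

text \<open>
  Since \<open>m\<close> is at least a multiple of \<open>n / b\<close>, the first summand is of order \<open>p\<^sup>2\<close>. In the second,
  the constant part of \<open>\<gamma>\<close> gives a term of order \<open>q\<^sup>2\<close>. The rest of \<open>\<gamma>\<close> may be of the order of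
  \<open>sqrt (b / m)\<close>, that is of \<open>p / q\<close>, and the resulting term \<open>p q\<close> is still below the square of
  \<open>p + q\<close>.
\<close>

lemma inverse_step_size_bound:
  fixes n m b :: nat and c :: real
  assumes c: "0 < c" and b: "1 \<le> b" and n: "1 \<le> n" and m: "1 \<le> m"
    and low: "c * real n / real b \<le> real m"
  shows "1 / (real m * (real m + 1)) + gamma_star m b / (real b * real m)
    \<le> condition_constant c * (real b / real n + 1 / sqrt (real n))\<^sup>2"
proof -
  let ?p = "real b / real n" and ?q = "1 / sqrt (real n)"
  have p: "?p > 0" and q: "?q > 0" using b n by auto
  have q2: "?q\<^sup>2 = 1 / real n" by (simp add: power_divide)
  have mp: "c / ?p \<le> real m" using low by simp
  have m_inv: "1 / real m \<le> ?p / c"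
  proof -
    have "0 < c / ?p" by (rule divide_pos_pos[OF c p])
    then have "1 / real m \<le> 1 / (c / ?p)"
      using m by (intro divide_left_mono[OF mp] mult_pos_pos) auto
    then show ?thesis by (simp add: mult.commute)
  qed
  have bm: "c * real n \<le> real b * real m"
    using low b by (simp add: field_simps)
  have t1: "1 / (real m * (real m + 1)) \<le> 1 / c\<^sup>2 * ?p\<^sup>2"
  proof -
    have "1 / (real m * (real m + 1)) \<le> 1 / (real m * real m)"
      using m by (intro divide_left_mono mult_left_mono) auto
    also have "\<dots> = (1 / real m)\<^sup>2" by (simp add: power2_eq_square)
    also have "\<dots> \<le> (?p / c)\<^sup>2" using m_inv by (intro power_mono) auto
    finally show ?thesis by (simp add: power_divide power_mult_distrib mult.commute)
  qed
  have g: "gamma_star m b \<le> 3 + sqrt (2 / c) * (?p / ?q)"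
  proof -
    have "2 * real b / (real m + 1) \<le> 2 * real b / real m"
      using m by (intro divide_left_mono) auto
    also have "\<dots> = 2 * real b * (1 / real m)" by simp
    also have "\<dots> \<le> 2 * real b * (?p / c)" using m_inv by (intro mult_left_mono) auto
    also have "\<dots> = 2 / c * (?p / ?q)\<^sup>2"
      unfolding power_divide q2 using n by (simp add: power2_eq_square mult_ac)
    finally have "sqrt (2 * real b / (real m + 1)) \<le> sqrt (2 / c * (?p / ?q)\<^sup>2)"
      by (rule real_sqrt_le_mono)
    also have "\<dots> = sqrt (2 / c) * (?p / ?q)"
      unfolding real_sqrt_mult using p q by simp
    finally show ?thesis using gamma_star_le[of m b] by linarith
  qed
  have t2: "gamma_star m b / (real b * real m) \<le> 3 / c * ?q\<^sup>2 + sqrt (2 / c) / c * (?p * ?q)"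
  proof -
    have "gamma_star m b / (real b * real m) \<le> gamma_star m b / (c * real n)"
      using bm c n gamma_star_ge_3[of m b] b m by (intro divide_left_mono) auto
    also have "\<dots> \<le> (3 + sqrt (2 / c) * (?p / ?q)) / (c * real n)"
      using g c by (intro divide_right_mono) auto
    also have "\<dots> = 3 / c * (1 / real n) + sqrt (2 / c) / c * (?p / ?q * (1 / real n))"
      by (simp add: add_divide_distrib)
    also have "?p / ?q * (1 / real n) = ?p * ?q"
    proof -
      have "p / r * r\<^sup>2 = p * r" if "r > 0" for p r :: real
        using that by (simp add: power2_eq_square)
      from this[OF q, of ?p] show ?thesis unfolding q2 .
    qed
    finally show ?thesis unfolding q2 .
  qed
  have "?p\<^sup>2 \<le> (?p + ?q)\<^sup>2" "?q\<^sup>2 \<le> (?p + ?q)\<^sup>2" using p q by (intro power_mono; simp)+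
  moreover have "?p * ?q \<le> (?p + ?q)\<^sup>2"
  proof -
    have "?p * ?q \<le> (?p + ?q) * (?p + ?q)" using p q by (intro mult_mono) auto
    then show ?thesis by (simp only: power2_eq_square)
  qed
  ultimately have "1 / c\<^sup>2 * ?p\<^sup>2 + (3 / c * ?q\<^sup>2 + sqrt (2 / c) / c * (?p * ?q))
      \<le> 1 / c\<^sup>2 * (?p + ?q)\<^sup>2 + (3 / c * (?p + ?q)\<^sup>2 + sqrt (2 / c) / c * (?p + ?q)\<^sup>2)"
    using c by (intro add_mono mult_left_mono) auto
  also have "\<dots> = condition_constant c * (?p + ?q)\<^sup>2"
    by (simp only: condition_constant_def distrib_right add.assoc)
  finally show ?thesis using t1 t2 by linarith
qed

text \<open>
  Here \<open>\<gamma> \<ge> 3\<close> bounds \<open>(1 - 1 / \<gamma>)\<^sup>2\<close> below by \<open>4 / 9\<close>, which is where the \<open>9\<close> comes from.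
\<close>

lemma rho_le:
  fixes n m b S :: nat
  assumes c: "0 < c" and b: "1 \<le> b" and n: "1 \<le> n" and m: "1 \<le> m"
    and low: "c * real n / real b \<le> real m"
    and L: "Lbar n L > 0" and \<mu>: "\<mu> > 0"
  defines "X \<equiv> (real b / real n + 1 / sqrt (real n)) * sqrt (Lbar n L / \<mu>)"
  defines "\<gamma> \<equiv> gamma_star m b"
  shows "rho \<gamma> (step_size n L \<gamma> m b) \<mu> m S
      \<le> 4 * (1 + 9 * condition_constant c * X\<^sup>2) / (real S + 2)\<^sup>2"
    and "0 < rho \<gamma> (step_size n L \<gamma> m b) \<mu> m S"
proof -
  let ?\<eta> = "step_size n L \<gamma> m b" and ?a = "1 - 1 / \<gamma>"
  let ?k = "?\<eta> * (real m + 1) * real m * \<mu>"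
  have \<gamma>: "3 \<le> \<gamma>" unfolding \<gamma>_def by (rule gamma_star_ge_3)
  have a: "2 / 3 \<le> ?a" using \<gamma> by (simp add: field_simps)
  have \<eta>: "?\<eta> > 0" using \<gamma> L b by (simp add: step_size_def add_pos_nonneg)
  have k: "?k > 0" using \<eta> m \<mu> by simp
  have a2: "4 / 9 \<le> ?a\<^sup>2" using power_mono[OF a, of 2] by (simp add: power_divide)
  have "1 / ?k = (1 / (real m * (real m + 1)) + \<gamma> / (real b * real m)) * (Lbar n L / \<mu>)"
  proof -
    have "1 / (1 / ((1 + \<gamma> * M / real b) * Lbar n L) * M * real m * \<mu>)
        = (1 / (real m * M) + \<gamma> / (real b * real m)) * (Lbar n L / \<mu>)" if "M > 0" for M
      using that b m \<mu> by (simp add: field_simps)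
    then show ?thesis unfolding step_size_def by simp
  qed
  also have "\<dots> \<le> condition_constant c * (real b / real n + 1 / sqrt (real n))\<^sup>2 * (Lbar n L / \<mu>)"
    unfolding \<gamma>_def using inverse_step_size_bound[OF c b n m low] L \<mu>
    by (intro mult_right_mono) auto
  also have "\<dots> = condition_constant c * X\<^sup>2"
    unfolding X_def power_mult_distrib using L \<mu> by simp
  finally have kX: "1 / ?k \<le> condition_constant c * X\<^sup>2" .
  have "4 / ?k / ?a\<^sup>2 \<le> 4 / ?k / (4 / 9)"
    using a2 k by (intro divide_left_mono) auto
  also have "\<dots> = 9 * (1 / ?k)" by simp
  also have "\<dots> \<le> 9 * (condition_constant c * X\<^sup>2)"
    using kX by (intro mult_left_mono) auto
  finally have "1 + 4 / ?k / ?a\<^sup>2 \<le> 1 + 9 * (condition_constant c * X\<^sup>2)"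
    by (rule add_left_mono)
  then have "4 * (1 + 4 / ?k / ?a\<^sup>2) / (real S + 2)\<^sup>2
      \<le> 4 * (1 + 9 * (condition_constant c * X\<^sup>2)) / (real S + 2)\<^sup>2"
    by (intro divide_right_mono mult_left_mono) auto
  moreover have "rho \<gamma> ?\<eta> \<mu> m S = 4 * (1 + 4 / ?k / ?a\<^sup>2) / (real S + 2)\<^sup>2"
  proof -
    have "4 * (A + B) / (A * D) = 4 * (1 + B / A) / D" if "A > 0" for A B D :: real
      using that by (simp add: field_simps)
    from this[of "?a\<^sup>2" "4 / ?k" "(real S + 2)\<^sup>2"] a2 show ?thesis by (simp only: rho_def)
  qed
  ultimately show "rho \<gamma> ?\<eta> \<mu> m S \<le> 4 * (1 + 9 * condition_constant c * X\<^sup>2) / (real S + 2)\<^sup>2"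
    by (simp only: mult.assoc)
  have "?a\<^sup>2 + 4 / ?k > 0" using a2 divide_pos_pos[OF _ k, of 4] by linarith
  moreover have "?a\<^sup>2 * (real S + 2)\<^sup>2 > 0" using a2 by (intro mult_pos_pos) auto
  ultimately show "0 < rho \<gamma> ?\<eta> \<mu> m S" unfolding rho_def by simp
qed

lemma exists_stage_count:
  fixes K X :: real
  assumes K: "0 \<le> K" and X: "0 \<le> X"
  shows "\<exists>S::nat. 1 \<le> S \<and> real S \<le> (5 + 12 * sqrt K) * (1 + X)
    \<and> 4 * (1 + 9 * K * X\<^sup>2) / (real S + 2)\<^sup>2 \<le> 1 / 4"
proof -
  define k where "k = sqrt K"
  have K0: "0 \<le> k" and k2: "k\<^sup>2 = K" using K by (simp_all add: k_def)
  (* (S + 2)^2 is then at least 16 (1 + 3 k X)^2, and 16 = 4 * 4 turns the factor 4 into 1 / 4;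
     rounding up adds at most 1 + X, hence the 5 *)
  define M where "M = 4 * (1 + 3 * k) * (1 + X)"
  define S where "S = nat \<lceil>M\<rceil>"
  have "4 * (1 + 3 * k) * 1 \<le> M" unfolding M_def using K0 X by (intro mult_left_mono) auto
  then have M4: "4 \<le> M" using K0 by simp
  have S: "M \<le> real S" "real S \<le> M + 1" unfolding S_def using M4 by linarith+
  have "real S \<le> M + 1 * (1 + X)" using S X by simp
  also have "\<dots> = (5 + 12 * k) * (1 + X)" unfolding M_def by (simp add: algebra_simps)
  finally have up: "real S \<le> (5 + 12 * sqrt K) * (1 + X)" unfolding k_def .
  define t where "t = 3 * k * X"
  have t0: "0 \<le> t" using K0 X by (simp add: t_def)
  have "4 * (1 + t) \<le> M" unfolding M_def t_def using K0 X by (simp add: algebra_simps)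
  then have "4 * (1 + t) \<le> real S + 2" using S by linarith
  then have "(4 * (1 + t))\<^sup>2 \<le> (real S + 2)\<^sup>2" using t0 by (intro power_mono) auto
  moreover have "16 * (1 + t\<^sup>2) \<le> (4 * (1 + t))\<^sup>2"
    using t0 by (simp add: power2_eq_square algebra_simps)
  moreover have "t\<^sup>2 = 9 * K * X\<^sup>2" using k2 by (simp add: t_def power_mult_distrib)
  ultimately have "16 * (1 + 9 * K * X\<^sup>2) \<le> (real S + 2)\<^sup>2" by simp
  then have "4 * (1 + 9 * K * X\<^sup>2) / (real S + 2)\<^sup>2 \<le> 1 / 4"
    by (simp add: divide_le_eq)
  moreover have "1 \<le> S" using S M4 by linarith
  ultimately show ?thesis using up by blast
qed

lemma one_le_ln_inverse:
  assumes "0 < r" "r \<le> 1 / (4::real)"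
  shows "1 \<le> ln (1 / r)"
proof -
  have "4 \<le> 1 / r" using assms by (simp add: field_simps)
  then have "exp 1 \<le> 1 / r" using exp_le by linarith
  then show ?thesis using assms by (subst ln_ge_iff) auto
qed

text \<open>
  The assumption \<open>\<epsilon> \<le> D / 2\<close> keeps the logarithm above \<open>ln 2 \<ge> 1 / 2\<close>, so that rounding up costs
  at most a factor \<open>3\<close>.
\<close>

lemma exists_restart_count:
  fixes r \<epsilon> D :: real
  assumes r: "0 < r" "r \<le> 1 / 4" and \<epsilon>: "0 < \<epsilon>" "\<epsilon> \<le> D / 2"
  shows "\<exists>T::nat. real T \<le> 3 * ln (D / \<epsilon>) \<and> r ^ T * D \<le> \<epsilon>"
proof -
  let ?l = "ln (D / \<epsilon>)"
  have D: "D > 0" and two: "2 \<le> D / \<epsilon>" using \<epsilon> by (auto simp: field_simps)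
  have "1 / 2 \<le> ln (2::real)"
  proof -
    have "(exp (1 / 2 :: real))\<^sup>2 = exp 1" by (simp add: power2_eq_square flip: exp_add)
    also have "\<dots> \<le> 2\<^sup>2" using exp_le by simp
    finally have "exp (1 / 2 :: real) \<le> 2" by (rule power2_le_imp_le) simp
    then show ?thesis by (subst ln_ge_iff) auto
  qed
  also have "\<dots> \<le> ?l" using two by simp
  finally have l: "1 / 2 \<le> ?l" .
  define T where "T = nat \<lceil>?l\<rceil>"
  have T: "?l \<le> real T" "real T \<le> ?l + 1" unfolding T_def using l by linarith+
  have "exp 1 \<le> (4 :: real)" using exp_le by linarith
  then have "1 / 4 \<le> exp (- 1 :: real)" by (simp add: exp_minus field_simps)
  then have "r \<le> exp (- 1)" using r by linarith
  then have "r ^ T \<le> exp (- 1) ^ T" using r by (intro power_mono) auto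
  also have "\<dots> = exp (- real T)" by (simp add: exp_of_nat_mult[symmetric])
  also have "\<dots> \<le> exp (- ?l)" using T by simp
  also have "\<dots> = \<epsilon> / D" using D \<epsilon> by (simp add: exp_minus)
  finally have "r ^ T * D \<le> \<epsilon>" using D by (simp add: field_simps)
  moreover have "real T \<le> 3 * ?l" using T l by linarith
  ultimately show ?thesis by blast
qed

lemma stage_cost_le:
  fixes n m b :: nat and v c2 :: real
  assumes cost: "\<And>op. 0 \<le> cost op \<and> cost op \<le> v" and b: "1 \<le> b" and n: "1 \<le> n"
    and up: "real m \<le> c2 * real n / real b"
  shows "stage_cost cost n m b \<le> (8 + 19 * c2) * (real n * v)"
proof -
  have v: "0 \<le> v" using cost[of Vec_Op] by linarith
  have bm: "real b * real m \<le> c2 * real n" using up b by (simp add: field_simps)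
  have mb: "real m \<le> real b * real m" using b by (simp add: mult_le_cancel_right1)
  have "inner_iter_cost cost b \<le> real b * (2 * v + 3 * v) + 13 * v + v"
    unfolding inner_iter_cost_def
    using cost[of Grad_Eval] cost[of Vec_Op] cost[of Prox_Eval]
    by (intro add_mono mult_left_mono) auto
  then have "real m * inner_iter_cost cost b \<le> real m * (real b * (2 * v + 3 * v) + 13 * v + v)"
    by (rule mult_left_mono) simp
  also have "\<dots> = 5 * (real b * real m) * v + 14 * real m * v" by (simp add: algebra_simps)
  also have "\<dots> \<le> 5 * (c2 * real n) * v + 14 * (c2 * real n) * v"
    using bm mb v by (intro add_mono mult_right_mono mult_left_mono) auto
  finally have 1: "real m * inner_iter_cost cost b \<le> 19 * c2 * (real n * v)"
    by (simp add: algebra_simps)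
  have 2: "full_grad_cost cost n \<le> real n * v + real n * v"
    unfolding full_grad_cost_def using cost by (intro add_mono mult_left_mono) auto
  have "6 * v \<le> 6 * (real n * v)" using n v by (simp add: mult_le_cancel_right1)
  then have 3: "6 * cost Vec_Op \<le> 6 * (real n * v)" using cost[of Vec_Op] by linarith
  show ?thesis unfolding stage_cost_def using 1 2 3 by (simp add: algebra_simps)
qed

theorem corollary5p5:
  fixes c1 c2 :: real
  assumes "0 < c1" and "c1 \<le> c2"
  shows "\<exists>C>0. \<forall>(d::nat) (n::nat) (f :: nat \<Rightarrow> vec \<Rightarrow> real) (L :: nat \<Rightarrow> real) (R :: vec \<Rightarrow> real)
      (\<mu>::real) (x0::vec) (xs::vec) (b::nat) (m::nat) (\<kappa>::real) (cost :: oper \<Rightarrow> real).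
    1 \<le> d \<and> 1 \<le> n \<and>
    (\<forall>i\<in>{1..n}. convex_on (Rd d) (f i) \<and> f i differentiable_on Rd d \<and>
       0 < L i \<and> (L i)-lipschitz_on (Rd d) (grad d (f i))) \<and>
    convex_on (Rd d) R \<and>
    minimizer d (Pobj n f R) xs \<and>
    0 < \<mu> \<and> opt_strongly_convex d \<mu> (Pobj n f R) \<and>
    x0 \<in> Rd d \<and> b \<in> {1..n} \<and>
    1 \<le> m \<and> c1 * real n / real b \<le> real m \<and> real m \<le> c2 * real n / real b \<and>
    (\<forall>op. 0 \<le> cost op \<and> cost op \<le> \<kappa> * real d)
    \<longrightarrow>
    (let \<gamma> = gamma_star m b;
         \<eta> = step_size n L \<gamma> m b;
         P = Pobj n f R;
         cond = sqrt (Lbar n L / \<mu>)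
     in \<exists>S::nat. 1 \<le> S \<and>
          real S \<le> C * (1 + (real b / real n + 1 / sqrt (real n)) * cond) \<and>
          0 < rho \<gamma> \<eta> \<mu> m S \<and> rho \<gamma> \<eta> \<mu> m S < 1 \<and>
          1 / ln (1 / rho \<gamma> \<eta> \<mu> m S) \<le> C \<and>
          (\<forall>\<epsilon>>0. \<epsilon> \<le> (P x0 - P xs) / 2 \<longrightarrow>
            (\<exists>T::nat. real T \<le> C * ln ((P x0 - P xs) / \<epsilon>) \<and>
               measure_pmf.expectation (dasvrda_sc cost d n f L R x0 \<gamma> m b S T)
                 (\<lambda>(x, c). P x - P xs) \<le> \<epsilon> \<and>
               (\<forall>(x, c) \<in> set_pmf (dasvrda_sc cost d n f L R x0 \<gamma> m b S T).
                  c \<le> C * \<kappa> * (real d * (real n + (real b + sqrt (real n)) * cond)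
                             * ln ((P x0 - P xs) / \<epsilon>))))))"
proof -
  define K where "K = condition_constant c1"
  have K: "0 \<le> K" using assms by (simp add: K_def condition_constant_def)
  define M where "M = 5 + 12 * sqrt K"
  (* the product of the constants for restarts, for stages and for the cost of a stage *)
  define C where "C = 3 * M * (8 + 19 * c2)"
  have M5: "5 \<le> M" using K by (simp add: M_def)
  have c2: "0 < c2" using assms by simp
  have MC: "M \<le> C"
  proof -
    have "M * 1 \<le> M * (3 * (8 + 19 * c2))" using M5 c2 by (intro mult_left_mono) auto
    then show ?thesis by (simp add: C_def mult_ac)
  qed
  have C: "3 \<le> C" "0 < C" using MC M5 by auto
  show ?thesis
  proof (intro exI[of _ C] conjI C allI impI, elim conjE)
    fix d n :: nat and f :: "nat \<Rightarrow> vec \<Rightarrow> real" and L :: "nat \<Rightarrow> real" and R :: "vec \<Rightarrow> real"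
      and \<mu> :: real and x0 xs :: vec and b m :: nat and \<kappa> :: real and cost :: "oper \<Rightarrow> real"
    assume d: "1 \<le> d" and n: "1 \<le> n"
      and f: "\<forall>i\<in>{1..n}. convex_on (Rd d) (f i) \<and> f i differentiable_on Rd d \<and>
         0 < L i \<and> (L i)-lipschitz_on (Rd d) (grad d (f i))"
      and R: "convex_on (Rd d) R" and xs: "minimizer d (Pobj n f R) xs"
      and \<mu>: "0 < \<mu>" "opt_strongly_convex d \<mu> (Pobj n f R)" and x0: "x0 \<in> Rd d" and b: "b \<in> {1..n}"
      and m: "1 \<le> m" "c1 * real n / real b \<le> real m" "real m \<le> c2 * real n / real b"
      and cost: "\<forall>op. 0 \<le> cost op \<and> cost op \<le> \<kappa> * real d"
    interpret composite_problem d n f L R xs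
      using n f R xs by unfold_locales auto
    let ?\<gamma> = "gamma_star m b"
    let ?\<eta> = "step_size n L ?\<gamma> m b"
    let ?cond = "sqrt (Lb / \<mu>)"
    define X where "X = (real b / real n + 1 / sqrt (real n)) * ?cond"
    have b1: "1 \<le> b" using b by simp
    have \<gamma>: "3 \<le> ?\<gamma>" by (rule gamma_star_ge_3)
    have X: "0 \<le> X" using Lb_pos \<mu> by (simp add: X_def)
    obtain S :: nat where S: "1 \<le> S" "real S \<le> M * (1 + X)"
        "4 * (1 + 9 * K * X\<^sup>2) / (real S + 2)\<^sup>2 \<le> 1 / 4"
      using exists_stage_count[OF K X] unfolding M_def by blast
    let ?r = "rho ?\<gamma> ?\<eta> \<mu> m S"
    note rho = rho_le[OF assms(1) b1 n m(1,2) Lb_pos \<mu>(1), of S, folded X_def K_def]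
    have r: "0 < ?r" "?r \<le> 1 / 4" using rho S(3) by linarith+
    have ln_r: "1 / ln (1 / ?r) \<le> C"
      using one_le_ln_inverse[OF r] C by (smt (verit) divide_le_eq_1)
    have nX: "real n * (1 + X) = real n + (real b + sqrt (real n)) * ?cond"
    proof -
      have "real n * (1 / sqrt (real n)) = sqrt (real n)" by (simp add: real_div_sqrt)
      moreover have "real n * (real b / real n) = real b" using n by simp
      ultimately have "real n * (real b / real n + 1 / sqrt (real n)) = real b + sqrt (real n)"
        by (simp only: distrib_left)
      then show ?thesis by (simp only: X_def distrib_left mult.assoc[symmetric] mult_1_right)
    qed
    have \<kappa>: "0 \<le> \<kappa> * real d" using cost[rule_format, of Vec_Op] by linarith
    have SC: "real S \<le> C * (1 + X)"
      using S(2) mult_right_mono[OF MC, of "1 + X"] X by linarith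
    have restart: "\<exists>T::nat. real T \<le> C * ln ((P x0 - P xs) / \<epsilon>) \<and>
         measure_pmf.expectation (dasvrda_sc cost d n f L R x0 ?\<gamma> m b S T) (\<lambda>(x, c). P x - P xs)
             \<le> \<epsilon> \<and>
         (\<forall>(x, c) \<in> set_pmf (dasvrda_sc cost d n f L R x0 ?\<gamma> m b S T).
            c \<le> C * \<kappa> * (real d * (real n + (real b + sqrt (real n)) * ?cond)
                       * ln ((P x0 - P xs) / \<epsilon>)))"
      if \<epsilon>: "0 < \<epsilon>" "\<epsilon> \<le> (P x0 - P xs) / 2" for \<epsilon>
    proof -
      let ?l = "ln ((P x0 - P xs) / \<epsilon>)"
      obtain T :: nat where T: "real T \<le> 3 * ?l" "?r ^ T * (P x0 - P xs) \<le> \<epsilon>"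
        using exists_restart_count[OF r \<epsilon>] by blast
      have l: "0 \<le> ?l" using T(1) by linarith
      have "real T \<le> C * ?l" using T(1) mult_right_mono[OF C(1) l] by linarith
      moreover have "measure_pmf.expectation (dasvrda_sc cost d n f L R x0 ?\<gamma> m b S T)
          (\<lambda>(x, c). P x - P xs) \<le> \<epsilon>"
        using dasvrda_sc_convergence[OF \<gamma> m(1) b1 x0 \<mu>] T(2) by (rule order_trans)
      moreover have "c \<le> C * \<kappa> * (real d * (real n + (real b + sqrt (real n)) * ?cond) * ?l)"
        if "(x, c) \<in> set_pmf (dasvrda_sc cost d n f L R x0 ?\<gamma> m b S T)" for x c
      proof -
        let ?v = "\<kappa> * real d"
        have "c = real T * (real S * stage_cost cost n m b)" by (rule dasvrda_sc_cost[OF that])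
        also have "\<dots> \<le> real T * (real S * ((8 + 19 * c2) * (real n * ?v)))"
          using cost by (intro mult_left_mono stage_cost_le b1 n m(3)) auto
        also have "\<dots> \<le> (3 * ?l) * ((M * (1 + X)) * ((8 + 19 * c2) * (real n * ?v)))"
        proof -
          have "0 \<le> (8 + 19 * c2) * (real n * ?v)"
            using c2 by (intro mult_nonneg_nonneg[OF _ mult_nonneg_nonneg[OF _ \<kappa>]]) auto
          then show ?thesis
            using mult_right_mono[OF S(2)] l by (intro mult_mono[OF T(1)]) auto
        qed
        also have "\<dots> = C * \<kappa> * (real d * (real n * (1 + X)) * ?l)"
          by (simp only: C_def mult_ac)
        finally show ?thesis unfolding nX .
      qed
      ultimately show ?thesis by blast
    qed
    show "let \<gamma> = gamma_star m b; \<eta> = step_size n L \<gamma> m b; P = Pobj n f R;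
        cond = sqrt (Lbar n L / \<mu>)
      in \<exists>S::nat. 1 \<le> S \<and>
          real S \<le> C * (1 + (real b / real n + 1 / sqrt (real n)) * cond) \<and>
          0 < rho \<gamma> \<eta> \<mu> m S \<and> rho \<gamma> \<eta> \<mu> m S < 1 \<and>
          1 / ln (1 / rho \<gamma> \<eta> \<mu> m S) \<le> C \<and>
          (\<forall>\<epsilon>>0. \<epsilon> \<le> (P x0 - P xs) / 2 \<longrightarrow>
            (\<exists>T::nat. real T \<le> C * ln ((P x0 - P xs) / \<epsilon>) \<and>
               measure_pmf.expectation (dasvrda_sc cost d n f L R x0 \<gamma> m b S T)
                 (\<lambda>(x, c). P x - P xs) \<le> \<epsilon> \<and>
               (\<forall>(x, c) \<in> set_pmf (dasvrda_sc cost d n f L R x0 \<gamma> m b S T).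
                  c \<le> C * \<kappa> * (real d * (real n + (real b + sqrt (real n)) * cond)
                             * ln ((P x0 - P xs) / \<epsilon>)))))"
      unfolding Let_def
    proof (rule exI[of _ S], intro conjI)
      show "real S \<le> C * (1 + (real b / real n + 1 / sqrt (real n)) * ?cond)"
        using SC unfolding X_def .
    qed (rule S(1) r(1) ln_r | use r in linarith | use restart in blast)+
  qed
qed

end
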